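(* Let $t_0>0$ and let $\varphi\colon[t_0,\infty)\to(0,\infty)$ be a non-decreasing function such that $\varphi(t)/t\to 0$ as $t\to\infty$ and $$\int_{t_0}^\infty\frac{dt}{t\,\varphi(t)}<\infty.$$ Let $D\subset\mathbb{C}$ be a domain, $z_0\in D$, and let $\mathcal{F}$ be a family of functions meromorphic in $D$ which is not normal at $z_0$. Then there exist a sequence $(f_k)$ in $\mathcal{F}$, a sequence $(z_k)$ in $D$, a sequence $(\varrho_k)$ of positive real numbers (with $1/\varrho_k\ge t_0$, so that $\varphi(1/\varrho_k)$ is defined) and a non-constant function $g$ meromorphic in $\mathbb{C}$ such that $z_k\to z_0$, $\varrho_k\to 0$, $$f_k(z_k+\varrho_k z)\to g(z)$$ locally uniformly in $\mathbb{C}$ with respect to the spherical metric, $g^\#(z)\le 1=g^\#(0)$ for all $z\in\mathbb{C}$, and such that moreover $$R_k:=\frac{1}{\varrho_k\,\varphi(1/\varrho_k)}\to\infty\quad\text{as }k\to\infty,$$ and the functions $g_k(z)=f_k(z_k+\varrho_k z)$ are defined in the disks $D(0,R_k)$ and satisfy $$g_k^\#(z)\le 1+\frac{|z|}{R_k}\quad\text{for }|z|<R_k.$$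
   Context: For a meromorphic function $f$, $f^\#(z)=\dfrac{|f'(z)|}{1+|f(z)|^2}$ denotes the spherical derivative (extended continuously to poles). $D(a,r)$ is the open disk of radius $r$ centered at $a\in\mathbb{C}$. A family of meromorphic functions is normal at $z_0$ if there is a neighborhood $U$ of $z_0$ such that every sequence in the family has a subsequence converging locally uniformly in $U$ with respect to the spherical metric (the constant limit $\infty$ is allowed). *)

theory Defs
  imports "HOL-Complex_Analysis.Complex_Analysis"
begin

text \<open>
  A meromorphic function on an open set is represented by a function that is
  \<^const>\<open>nicely_meromorphic_on\<close> it: removable singularities are filled in, and the value at a
  pole is the dummy 0. Its genuine value in the Riemann sphere is given by \<open>sphere_val\<close> below;
  the extended plane is \<^typ>\<open>complex option\<close>, with \<^const>\<open>None\<close> the point at infinity.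
\<close>

definition sphere_val :: "(complex \<Rightarrow> complex) \<Rightarrow> complex \<Rightarrow> complex option" where
  "sphere_val f z = (if is_pole f z then None else Some (f z))"

fun chordal_dist :: "complex option \<Rightarrow> complex option \<Rightarrow> real" where
  "chordal_dist (Some a) (Some b) =
     cmod (a - b) / (sqrt (1 + (cmod a)\<^sup>2) * sqrt (1 + (cmod b)\<^sup>2))"
| "chordal_dist (Some a) None = 1 / sqrt (1 + (cmod a)\<^sup>2)"
| "chordal_dist None (Some b) = 1 / sqrt (1 + (cmod b)\<^sup>2)"
| "chordal_dist None None = 0"

text \<open>
  The geodesic distance for the length element \<open>|dz| / (1 + |z|^2)\<close>, i.e. on the sphere of
  diameter 1, where a chord of length \<open>c\<close> subtends an arc of length \<open>arcsin c\<close>.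
\<close>

definition spherical_dist :: "complex option \<Rightarrow> complex option \<Rightarrow> real" where
  "spherical_dist p q = arcsin (chordal_dist p q)"

text \<open>
  Local uniformity is in the sense of neighbourhoods of points. The \<open>F n\<close> are total, but only
  their values on \<open>U\<close> for large \<open>n\<close> (locally) matter. The limit may take the value infinity.
\<close>

definition spherical_loc_uniform_limit ::
    "complex set \<Rightarrow> (nat \<Rightarrow> complex \<Rightarrow> complex option) \<Rightarrow> (complex \<Rightarrow> complex option) \<Rightarrow> bool" where
  "spherical_loc_uniform_limit U F G \<longleftrightarrow>
     (\<forall>z\<in>U. \<exists>V. open V \<and> z \<in> V \<and> V \<subseteq> U \<and>
        (\<forall>e>0. \<forall>\<^sub>F n in sequentially. \<forall>w\<in>V. spherical_dist (F n w) (G w) < e))"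

definition normal_at :: "complex set \<Rightarrow> (complex \<Rightarrow> complex) set \<Rightarrow> complex \<Rightarrow> bool" where
  "normal_at D \<F> z\<^sub>0 \<longleftrightarrow>
     (\<exists>U. open U \<and> z\<^sub>0 \<in> U \<and> U \<subseteq> D \<and>
        (\<forall>f::nat \<Rightarrow> complex \<Rightarrow> complex. range f \<subseteq> \<F> \<longrightarrow>
           (\<exists>r G. strict_mono r \<and>
              spherical_loc_uniform_limit U (\<lambda>n. sphere_val (f (r n))) G)))"

definition spherical_deriv :: "(complex \<Rightarrow> complex) \<Rightarrow> complex \<Rightarrow> real" where
  "spherical_deriv f z =
     (if is_pole f z
      then Lim (at z) (\<lambda>w. cmod (deriv f w) / (1 + (cmod (f w))\<^sup>2))
      else cmod (deriv f z) / (1 + (cmod (f z))\<^sup>2))"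

end

theory Submission
  imports Defs
begin

text \<open>
  Since the family is not normal at \<open>z\<^sub>0\<close>, the spherical derivatives are unbounded near \<open>z\<^sub>0\<close> by Marty's
  criterion: stereographic projection turns a bound on \<open>f\<^sup>#\<close> into a Lipschitz bound, and
  Arzela--Ascoli applies. Let \<open>H t\<close> be three times the integral of \<open>1 / (s \<phi> s)\<close> over \<open>s \<ge> t / 2\<close>.
  Starting from a point \<open>a\<close> close to \<open>z\<^sub>0\<close> where \<open>f\<^sup>#\<close> is large, minimise \<open>\<bar>\<zeta> - a\<bar> + H (f\<^sup># \<zeta>)\<close>. At a
  minimiser, with \<open>L = f\<^sup># \<zeta>\<close>, the decay of \<open>H\<close> forces \<open>f\<^sup># w \<le> L (1 + \<phi> L \<bar>w - \<zeta>\<bar>)\<close> for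
  \<open>\<bar>w - \<zeta>\<bar> < 1 / \<phi> L\<close>, which is the claimed bound for \<open>\<rho> = 1 / L\<close>. The rescaled functions are
  eventually Lipschitz on every disc, so a subsequence converges; locally the functions or their
  reciprocals converge as holomorphic functions, hence the spherical derivatives converge too, and
  the value 1 at the origin excludes a constant limit.
\<close>

section \<open>The Riemann sphere\<close>

definition sphere_inv :: "complex option \<Rightarrow> complex option" where
  "sphere_inv p = (case p of None \<Rightarrow> Some 0 | Some a \<Rightarrow> if a = 0 then None else Some (inverse a))"

text \<open>Stereographic projection onto the sphere of diameter 1 that touches the plane at the
  origin. With this diameter the Euclidean distance of the ambient space is exactly
  \<open>chordal_dist\<close>. Inner products are used so that squared norms expand
  algebraically.\<close>

definition riemann_point :: "complex option \<Rightarrow> complex \<times> real" where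
  "riemann_point p = (case p of None \<Rightarrow> (0, 1)
     | Some a \<Rightarrow> (a /\<^sub>R (1 + a \<bullet> a), (a \<bullet> a) / (1 + a \<bullet> a)))"

text \<open>The half-turn of that sphere about the axis through the images of 1 and -1.\<close>

definition sphere_flip :: "complex \<times> real \<Rightarrow> complex \<times> real" where
  "sphere_flip p = (cnj (fst p), 1 - snd p)"

lemma one_plus_inner_pos: "0 < 1 + a \<bullet> a" for a :: "'a::real_inner"
  by (simp add: add_pos_nonneg)

lemma one_plus_inner_nonzero [simp]: "1 + a \<bullet> a \<noteq> 0" for a :: "'a::real_inner"
  using one_plus_inner_pos[of a] by linarith

text \<open>Expanding the squares makes this a rational identity in \<open>a \<bullet> a\<close>,
  \<open>b \<bullet> b\<close> and \<open>a \<bullet> b\<close>. It embeds the extended plane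
  isometrically in a Euclidean space, so that compactness and uniform convergence can be handled
  there.\<close>

lemma dist_riemann_point: "dist (riemann_point p) (riemann_point q) = chordal_dist p q"
proof -
  have N: "dist (0::complex, 1::real) (riemann_point (Some a)) = 1 / sqrt (1 + (cmod a)\<^sup>2)" for a
  proof -
    let ?A = "1 + a \<bullet> a"
    have "(a \<bullet> a) / ?A\<^sup>2 + (1 - (a \<bullet> a) / ?A)\<^sup>2 = 1 / ?A"
      by (simp add: divide_simps) algebra
    moreover have "(cmod (a /\<^sub>R ?A))\<^sup>2 = (a \<bullet> a) / ?A\<^sup>2"
      by (simp add: power_mult_distrib power2_norm_eq_inner divide_inverse power_inverse)
    ultimately show ?thesis
      by (simp add: riemann_point_def dist_norm norm_Pair real_sqrt_divide power2_norm_eq_inner)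
  qed
  have S: "dist (riemann_point (Some a)) (riemann_point (Some b)) = chordal_dist (Some a) (Some b)" for a b
  proof -
    let ?A = "1 + a \<bullet> a" and ?B = "1 + b \<bullet> b"
    have "(cmod (a /\<^sub>R ?A - b /\<^sub>R ?B))\<^sup>2
          = (a \<bullet> a) / ?A\<^sup>2 + (b \<bullet> b) / ?B\<^sup>2 - 2 * (a \<bullet> b) / (?A * ?B)"
      unfolding power2_norm_eq_inner
      by (simp add: inner_diff_left inner_diff_right inner_commute divide_inverse power_inverse
          power2_eq_square)
    moreover have "(cmod (a - b))\<^sup>2 = a \<bullet> a + b \<bullet> b - 2 * (a \<bullet> b)"
      unfolding power2_norm_eq_inner by (simp add: inner_diff_left inner_diff_right inner_commute)
    \<comment> \<open>Here \<open>x\<close>, \<open>y\<close>, \<open>z\<close> stand for the three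
      inner products. Over the common denominator \<open>(A * B)\<^sup>2\<close> the numerator is
      divisible by \<open>A * B\<close>, because \<open>A = 1 + x\<close> and
      \<open>B = 1 + y\<close>.\<close>
    moreover have "x / A\<^sup>2 + y / B\<^sup>2 - 2 * z / (A * B) + (x / A - y / B)\<^sup>2 = (x + y - 2 * z) / (A * B)"
      if "A = 1 + x" "B = 1 + y" "A > 0" "B > 0" for x y z A B :: real
    proof -
      have "x / A\<^sup>2 + y / B\<^sup>2 - 2 * z / (A * B) + (x / A - y / B)\<^sup>2
         = (x * B\<^sup>2 + y * A\<^sup>2 - 2 * z * A * B + (x * B - y * A)\<^sup>2) / (A * B)\<^sup>2"
        using that(3,4) by (simp add: divide_simps) algebra
      also have "x * B\<^sup>2 + y * A\<^sup>2 - 2 * z * A * B + (x * B - y * A)\<^sup>2 = (x + y - 2 * z) * (A * B)"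
        unfolding that(1,2) by algebra
      finally show ?thesis using that(3,4) by (simp add: power2_eq_square)
    qed
    ultimately have "(cmod (a /\<^sub>R ?A - b /\<^sub>R ?B))\<^sup>2 + ((a \<bullet> a) / ?A - (b \<bullet> b) / ?B)\<^sup>2
        = (cmod (a - b))\<^sup>2 / (?A * ?B)"
      using one_plus_inner_pos by metis
    thus ?thesis
      by (simp add: riemann_point_def dist_norm norm_Pair real_sqrt_divide real_sqrt_mult
          power2_norm_eq_inner norm_eq_sqrt_inner[of "a - b"])
  qed
  show ?thesis
  proof (cases p; cases q)
    fix a b assume "p = Some a" "q = Some b"
    thus ?thesis using S by simp
  next
    fix a assume "p = Some a" "q = None"
    thus ?thesis using N by (simp add: riemann_point_def dist_commute)
  next
    fix a assume "p = None" "q = Some a"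
    thus ?thesis using N by (simp add: riemann_point_def)
  qed (simp add: riemann_point_def)
qed

text \<open>From 1/a = cnj a / |a|^2. Inversion is thus an isometry of the sphere, so a pole can be
  studied as a zero of the reciprocal.\<close>

lemma riemann_point_sphere_inv: "riemann_point (sphere_inv p) = sphere_flip (riemann_point p)"
proof (cases p)
  case (Some a)
  show ?thesis
  proof (cases "a = 0")
    case False
    have i: "inverse a = cnj a /\<^sub>R (a \<bullet> a)"
      using False
      by (simp add: complex_eq_iff inner_complex_def Re_divide Im_divide power2_eq_square
          divide_inverse cmod_def)
    have ii: "inverse a \<bullet> inverse a = inverse (a \<bullet> a)"
      by (simp add: dot_square_norm norm_inverse power_inverse)
    have "a \<bullet> a \<noteq> 0" using False by simp
    hence "inverse a /\<^sub>R (1 + inverse a \<bullet> inverse a) = cnj a /\<^sub>R (1 + a \<bullet> a)"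
      unfolding ii unfolding i by (simp add: divide_simps add.commute)
    moreover have "(inverse a \<bullet> inverse a) / (1 + inverse a \<bullet> inverse a) = 1 - (a \<bullet> a) / (1 + a \<bullet> a)"
      unfolding ii using \<open>a \<bullet> a \<noteq> 0\<close> by (simp add: divide_simps add.commute)
    ultimately show ?thesis
      using False by (simp add: Some riemann_point_def sphere_inv_def sphere_flip_def)
  qed (simp add: Some riemann_point_def sphere_inv_def sphere_flip_def)
qed (simp add: riemann_point_def sphere_inv_def sphere_flip_def)

lemma sphere_inv_sphere_inv [simp]: "sphere_inv (sphere_inv p) = p"
  by (cases p) (auto simp: sphere_inv_def)

text \<open>The product (1 + |a|^2) (1 + |b|^2) exceeds (|a| + |b|)^2 by the square (|a| |b| - 1)^2.
  The bound keeps the argument of \<open>arcsin\<close> in its domain.\<close>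

lemma chordal_dist_le_1: "chordal_dist p q \<le> 1"
proof -
  have "cmod (a - b) \<le> sqrt (1 + (cmod a)\<^sup>2) * sqrt (1 + (cmod b)\<^sup>2)" for a b
  proof -
    have "0 \<le> (cmod a * cmod b - 1)\<^sup>2" by simp
    hence "(cmod a + cmod b)\<^sup>2 \<le> (1 + (cmod a)\<^sup>2) * (1 + (cmod b)\<^sup>2)"
      by (simp add: power2_eq_square algebra_simps)
    hence "cmod a + cmod b \<le> sqrt ((1 + (cmod a)\<^sup>2) * (1 + (cmod b)\<^sup>2))"
      by (rule real_le_rsqrt)
    thus ?thesis using norm_triangle_ineq4[of a b] by (simp add: real_sqrt_mult)
  qed
  moreover have "1 \<le> sqrt (1 + (cmod a)\<^sup>2)" for a by simp
  ultimately show ?thesis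
    by (cases p; cases q) (auto simp: divide_le_eq add_pos_nonneg)
qed

lemma norm_riemann_point_le: "norm (riemann_point p) \<le> 1"
proof -
  have "riemann_point (Some 0) = 0" by (simp add: riemann_point_def zero_prod_def)
  thus ?thesis
    using chordal_dist_le_1[of p "Some 0"] by (simp flip: dist_riemann_point add: dist_norm)
qed

lemma spherical_dist_less:
  assumes "e > 0"
  obtains d where "d > 0" "\<And>p q. dist (riemann_point p) (riemann_point q) < d \<Longrightarrow> spherical_dist p q < e"
proof
  \<comment> \<open>The cap 1 is below \<pi>/2, where \<open>arcsin\<close> inverts
    \<open>sin\<close>.\<close>
  let ?d = "sin (min e 1)"
  have e1: "0 < min e 1" "min e 1 \<le> 1" "min e 1 < pi / 2" using assms pi_gt3 by auto
  show "?d > 0" using e1 by (intro sin_gt_zero) auto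
  fix p q assume *: "dist (riemann_point p) (riemann_point q) < ?d"
  have "arcsin (chordal_dist p q) < arcsin ?d"
  proof (subst arcsin_less_mono)
    show "\<bar>chordal_dist p q\<bar> \<le> 1"
      using chordal_dist_le_1[of p q] zero_le_dist[of "riemann_point p" "riemann_point q"]
      by (simp add: dist_riemann_point)
  qed (use * in \<open>auto simp: dist_riemann_point\<close>)
  also have "arcsin ?d = min e 1" using e1 by (intro arcsin_sin) auto
  finally show "spherical_dist p q < e" by (simp add: spherical_dist_def)
qed

text \<open>The optimal constant is 1; any constant suffices for equicontinuity.\<close>

lemma has_derivative_riemann_point:
  fixes f :: "complex \<Rightarrow> complex"
  assumes "(f has_field_derivative f') (at z)"
  obtains T where "((\<lambda>w. riemann_point (Some (f w))) has_derivative T) (at z)"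
    "\<And>v. norm (T v) \<le> 4 * (cmod f' / (1 + (cmod (f z))\<^sup>2)) * norm v"
proof
  let ?a = "f z" and ?A = "1 + f z \<bullet> f z"
  let ?T = "\<lambda>v. ((f' * v) /\<^sub>R ?A - (2 * (?a \<bullet> (f' * v)) / ?A\<^sup>2) *\<^sub>R ?a, 2 * (?a \<bullet> (f' * v)) / ?A\<^sup>2)"
  have f: "(f has_derivative (\<lambda>v. f' * v)) (at z)"
    using assms by (simp add: has_field_derivative_def)
  have 1: "((\<lambda>w. inverse (1 + f w \<bullet> f w)) has_derivative (\<lambda>v. - (2 * (?a \<bullet> (f' * v)) / ?A\<^sup>2))) (at z)"
    by (rule derivative_eq_intros f refl | simp)+
       (auto simp: fun_eq_iff inner_commute divide_inverse power2_eq_square)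
  have "((\<lambda>w. (f w /\<^sub>R (1 + f w \<bullet> f w), 1 - inverse (1 + f w \<bullet> f w))) has_derivative ?T) (at z)"
    by (rule derivative_eq_intros f 1 refl | simp)+
       (auto simp: fun_eq_iff inner_commute divide_inverse power2_eq_square simp flip: scaleR_add_left)
  also have "(\<lambda>w. (f w /\<^sub>R (1 + f w \<bullet> f w), 1 - inverse (1 + f w \<bullet> f w))) = (\<lambda>w. riemann_point (Some (f w)))"
    by (auto simp: riemann_point_def fun_eq_iff field_simps)
  finally show "((\<lambda>w. riemann_point (Some (f w))) has_derivative ?T) (at z)" .
  fix v
  let ?u = "cmod (f' * v)" and ?c = "2 * (?a \<bullet> (f' * v)) / ?A\<^sup>2"
  have A: "?A > 0" "cmod ?a * cmod ?a \<le> ?A" "2 * cmod ?a \<le> ?A"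
    using zero_le_power2[of "cmod ?a - 1"] one_plus_inner_pos[of ?a]
    by (auto simp: dot_square_norm power2_eq_square algebra_simps)
  have c: "\<bar>?c\<bar> \<le> 2 * (cmod ?a * ?u) / ?A\<^sup>2"
    using A(1) Cauchy_Schwarz_ineq2[of ?a "f' * v"] by (simp add: abs_mult divide_right_mono)
  have "norm (?T v) \<le> norm ((f' * v) /\<^sub>R ?A - ?c *\<^sub>R ?a) + \<bar>?c\<bar>"
    using norm_Pair_le[of "(f' * v) /\<^sub>R ?A - ?c *\<^sub>R ?a" ?c] unfolding real_norm_def .
  \<comment> \<open>The three summands are at most 1, 2 and 1 times \<open>?u / ?A\<close>, which
    yields the constant 4.\<close>
  also have "\<dots> \<le> ?u / ?A + \<bar>?c\<bar> * cmod ?a + \<bar>?c\<bar>"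
    using norm_triangle_ineq4[of "(f' * v) /\<^sub>R ?A" "?c *\<^sub>R ?a"] A(1) by (simp add: divide_inverse mult.commute)
  also have "\<bar>?c\<bar> * cmod ?a \<le> 2 * ?u / ?A"
  proof -
    have "\<bar>?c\<bar> * cmod ?a \<le> 2 * (cmod ?a * ?u) / ?A\<^sup>2 * cmod ?a"
      using c by (rule mult_right_mono) simp
    also have "\<dots> = 2 * ?u * (cmod ?a * cmod ?a) / ?A\<^sup>2" by simp
    also have "\<dots> \<le> 2 * ?u * ?A / ?A\<^sup>2"
      using A by (intro divide_right_mono mult_left_mono) auto
    also have "\<dots> = 2 * ?u / ?A" using A by (simp add: power2_eq_square)
    finally show ?thesis .
  qed
  also have "\<bar>?c\<bar> \<le> ?u / ?A"
  proof -
    have "2 * (cmod ?a * ?u) / ?A\<^sup>2 = (2 * cmod ?a) * ?u / ?A\<^sup>2" by simp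
    also have "\<dots> \<le> ?A * ?u / ?A\<^sup>2"
      using A by (intro divide_right_mono mult_right_mono) auto
    also have "\<dots> = ?u / ?A" using A by (simp add: power2_eq_square)
    finally show ?thesis using c by linarith
  qed
  finally show "norm (?T v) \<le> 4 * (cmod f' / (1 + (cmod (f z))\<^sup>2)) * norm v"
    by (simp add: norm_mult dot_square_norm)
qed

section \<open>Spherical derivatives of meromorphic functions\<close>

lemma sphere_val_analytic:
  assumes "f analytic_on {z}"
  shows "\<not> is_pole f z" "sphere_val f z = Some (f z)"
    "spherical_deriv f z = cmod (deriv f z) / (1 + (cmod (f z))\<^sup>2)"
proof -
  show "\<not> is_pole f z"
    using assms analytic_at not_is_pole_holomorphic by blast
  thus "sphere_val f z = Some (f z)"
    "spherical_deriv f z = cmod (deriv f z) / (1 + (cmod (f z))\<^sup>2)"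
    by (auto simp: sphere_val_def spherical_deriv_def)
qed

text \<open>The factor |f|^2 in the denominator of |(1/f)'| is absorbed by |f|^2 (1 + |1/f|^2) = 1 +
  |f|^2.\<close>

lemma spherical_deriv_inverse_at:
  assumes "f analytic_on {z}" "f z \<noteq> 0"
  shows "cmod (deriv (\<lambda>w. inverse (f w)) z) / (1 + (cmod (inverse (f z)))\<^sup>2)
       = cmod (deriv f z) / (1 + (cmod (f z))\<^sup>2)"
proof -
  have "(f has_field_derivative deriv f z) (at z)"
    using assms(1) by (simp add: analytic_on_imp_differentiable_at DERIV_deriv_iff_field_differentiable)
  from DERIV_inverse_fun[OF this assms(2)]
  have "deriv (\<lambda>w. inverse (f w)) z = - (deriv f z * inverse (f z ^ Suc (Suc 0)))"
    by (rule DERIV_imp_deriv)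
  hence "cmod (deriv (\<lambda>w. inverse (f w)) z) = cmod (deriv f z) / (cmod (f z))\<^sup>2"
    by (simp add: norm_mult norm_inverse norm_power power2_eq_square divide_inverse)
  moreover have "(cmod (f z))\<^sup>2 * (1 + (inverse (cmod (f z)))\<^sup>2) = 1 + (cmod (f z))\<^sup>2"
    using assms(2) by (simp add: algebra_simps flip: power_mult_distrib)
  ultimately show ?thesis
    by (simp add: norm_inverse)
qed

text \<open>A pole of \<open>h\<close> would be a zero of \<open>f\<close>, so \<open>h\<close> has
  no singularities. At a pole of \<open>f\<close> the dummy value 0 together with
  \<open>inverse 0 = 0\<close> gives \<open>h\<close> its correct value. The spherical derivative of
  \<open>f\<close> is a limit there; it is found from the punctured neighbourhood, where the
  quotients of \<open>f\<close> and \<open>h\<close> agree, and from the continuity of the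
  latter.\<close>

lemma nicely_meromorphic_reciprocal:
  assumes f: "f nicely_meromorphic_on V" and "open V"
    and nz: "\<And>z. z \<in> V \<Longrightarrow> sphere_val f z \<noteq> Some 0"
  defines "h \<equiv> \<lambda>z. inverse (f z)"
  shows "h holomorphic_on V"
    and "\<And>z. z \<in> V \<Longrightarrow> sphere_val f z = sphere_inv (Some (h z))"
    and "\<And>z. z \<in> V \<Longrightarrow> spherical_deriv f z = cmod (deriv h z) / (1 + (cmod (h z))\<^sup>2)"
proof -
  have "\<not> is_pole h z" if "z \<in> V" for z
  proof
    assume "is_pole h z"
    hence z: "isolated_zero f z" by (simp add: h_def is_pole_inverse_iff)
    have "f nicely_meromorphic_on {z}"
      using f that by (meson empty_subsetI insert_subset nicely_meromorphic_on_subset)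
    with z have "f z = 0" "\<not> is_pole f z"
      using zero_isolated_zero_nicely_meromorphic pole_is_not_zero by blast+
    with nz[OF that] show False by (simp add: sphere_val_def)
  qed
  moreover have "h nicely_meromorphic_on V"
    unfolding h_def by (rule nicely_meromorphic_on_inverse[OF f])
  ultimately have h: "h analytic_on V" using nicely_meromorphic_without_singularities by blast
  thus holo: "h holomorphic_on V" by (rule analytic_imp_holomorphic)
  have 1: "sphere_val f z = Some (f z)" "f z \<noteq> 0" "f analytic_on {z}"
    if "z \<in> V" "\<not> is_pole f z" for z
    using nz[OF that(1)] that(2) nicely_meromorphic_on_imp_analytic_at[OF f that(1)]
    by (auto simp: sphere_val_def)
  show "sphere_val f z = sphere_inv (Some (h z))" if "z \<in> V" for z
  proof (cases "is_pole f z")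
    case True
    thus ?thesis
      using is_pole_zero_at_nicely_mero[OF f True that] by (simp add: sphere_val_def h_def sphere_inv_def)
  next
    case False
    thus ?thesis using 1[OF that] by (simp add: h_def sphere_inv_def)
  qed
  show "spherical_deriv f z = cmod (deriv h z) / (1 + (cmod (h z))\<^sup>2)" if z: "z \<in> V" for z
  proof (cases "is_pole f z")
    case True
    have "isolated_singularity_at f z"
      using f z by (simp add: nicely_meromorphic_on_def meromorphic_on_isolated_singularity
          meromorphic_on_subset[of f V "{z}"])
    hence "eventually (\<lambda>w. f analytic_on {w}) (at z)"
      by (simp add: isolated_singularity_at_altdef)
    moreover have "eventually (\<lambda>w. w \<in> V) (at z)"
      using \<open>open V\<close> z by (simp add: eventually_at_in_open')
    ultimately have ev: "eventually (\<lambda>w. cmod (deriv h w) / (1 + (cmod (h w))\<^sup>2)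
                      = cmod (deriv f w) / (1 + (cmod (f w))\<^sup>2)) (at z)"
    proof eventually_elim
      case (elim w)
      thus ?case unfolding h_def
        using 1(2) sphere_val_analytic(1) by (intro spherical_deriv_inverse_at) auto
    qed
    have "continuous_on V (\<lambda>w. cmod (deriv h w) / (1 + (cmod (h w))\<^sup>2))"
      using holo holomorphic_deriv[OF holo \<open>open V\<close>]
      by (intro continuous_intros holomorphic_on_imp_continuous_on) (auto simp: add_nonneg_eq_0_iff)
    hence "((\<lambda>w. cmod (deriv h w) / (1 + (cmod (h w))\<^sup>2)) \<longlongrightarrow> cmod (deriv h z) / (1 + (cmod (h z))\<^sup>2)) (at z)"
      using \<open>open V\<close> z by (simp add: continuous_on_eq_continuous_at isCont_def)
    hence "((\<lambda>w. cmod (deriv f w) / (1 + (cmod (f w))\<^sup>2)) \<longlongrightarrow> cmod (deriv h z) / (1 + (cmod (h z))\<^sup>2)) (at z)"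
      by (rule Lim_transform_eventually[OF _ ev])
    thus ?thesis using True by (simp add: spherical_deriv_def tendsto_Lim)
  next
    case False
    thus ?thesis unfolding h_def
      using spherical_deriv_inverse_at[OF 1(3,2)[OF z]] by (simp add: spherical_deriv_def)
  qed
qed

text \<open>Local coordinates on the sphere: \<open>f\<close> itself away from poles, its reciprocal
  near a pole. Later arguments about poles thereby reduce to a holomorphic \<open>h\<close>.\<close>

lemma nicely_meromorphic_chart:
  assumes f: "f nicely_meromorphic_on D" and "open D" "z \<in> D"
  obtains V h I where "open V" "z \<in> V" "V \<subseteq> D" "h holomorphic_on V" "I = id \<or> I = sphere_inv"
    "\<And>w. w \<in> V \<Longrightarrow> sphere_val f w = I (Some (h w))"
    "\<And>w. w \<in> V \<Longrightarrow> spherical_deriv f w = cmod (deriv h w) / (1 + (cmod (h w))\<^sup>2)"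
proof (cases "is_pole f z")
  case True
  have "eventually (\<lambda>w. f w \<noteq> 0) (at z)" by (rule non_zero_neighbour_pole[OF True])
  moreover have "eventually (\<lambda>w. w \<in> D) (at z)"
      using \<open>open D\<close> \<open>z \<in> D\<close> by (simp add: eventually_at_in_open')
  ultimately have "eventually (\<lambda>w. f w \<noteq> 0 \<and> w \<in> D) (at z)" by eventually_elim auto
  then obtain W where W: "open W" "z \<in> W" "\<And>w. w \<in> W \<Longrightarrow> w \<noteq> z \<Longrightarrow> f w \<noteq> 0 \<and> w \<in> D"
    unfolding eventually_at_topological by blast
  have "W \<subseteq> D" using W(3) \<open>z \<in> D\<close> by blast
  have "sphere_val f w \<noteq> Some 0" if "w \<in> W" for w
    using that W(3) True by (cases "w = z") (auto simp: sphere_val_def)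
  note rec = nicely_meromorphic_reciprocal[OF nicely_meromorphic_on_subset[OF f \<open>W \<subseteq> D\<close>] W(1) this]
  show ?thesis using W(1,2) \<open>W \<subseteq> D\<close> rec(1) disjI2[OF refl] rec(2,3) by (rule that)
next
  case False
  hence "f analytic_on {z}" using nicely_meromorphic_on_imp_analytic_at[OF f \<open>z \<in> D\<close>] by blast
  then obtain W where W: "open W" "z \<in> W" "f holomorphic_on W" using analytic_at by blast
  have "f holomorphic_on W \<inter> D" using W(3) holomorphic_on_subset by blast
  moreover have "f analytic_on {w}" if "w \<in> W" for w
    using W that analytic_at by blast
  ultimately show ?thesis
    using W \<open>open D\<close> \<open>z \<in> D\<close> sphere_val_analytic
    by (intro that[of "W \<inter> D" f id]) auto
qed

lemma sphere_flip_isometry: "dist (sphere_flip p) (sphere_flip q) = dist p q"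
proof -
  have "dist (cnj x) (cnj y) = dist x y" for x y
    by (metis complex_cnj_diff complex_mod_cnj dist_norm)
  thus ?thesis
    by (simp add: sphere_flip_def dist_prod_def dist_real_def abs_minus_commute)
qed

lemma continuous_on_spherical_deriv:
  assumes f: "f nicely_meromorphic_on D" and "open D"
  shows "continuous_on D (spherical_deriv f)"
proof -
  have "isCont (spherical_deriv f) z" if z: "z \<in> D" for z
  proof -
    obtain V h I where V: "open V" "z \<in> V" "h holomorphic_on V"
      and h: "\<And>w. w \<in> V \<Longrightarrow> spherical_deriv f w = cmod (deriv h w) / (1 + (cmod (h w))\<^sup>2)"
      using nicely_meromorphic_chart[OF assms z] by metis
    have "continuous_on V (\<lambda>w. cmod (deriv h w) / (1 + (cmod (h w))\<^sup>2))"
      using V holomorphic_deriv[OF V(3,1)]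
      by (intro continuous_intros holomorphic_on_imp_continuous_on) (auto simp: add_nonneg_eq_0_iff)
    hence "continuous_on V (spherical_deriv f)" using h by (simp cong: continuous_on_cong)
    thus ?thesis using V by (simp add: continuous_on_eq_continuous_at)
  qed
  thus ?thesis by (simp add: continuous_at_imp_continuous_on)
qed

text \<open>The mean value inequality for the projected map into Euclidean space. Inverted charts
  cost nothing, since the flip is an isometry.\<close>

lemma spherical_deriv_lipschitz:
  assumes f: "f nicely_meromorphic_on S" and S: "open S" "convex S"
    and B: "\<And>z. z \<in> S \<Longrightarrow> spherical_deriv f z \<le> B"
    and xy: "x \<in> S" "y \<in> S"
  shows "dist (riemann_point (sphere_val f x)) (riemann_point (sphere_val f y)) \<le> 4 * B * dist x y"
proof -
  let ?F = "\<lambda>z. riemann_point (sphere_val f z)"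
  have "\<exists>T. (?F has_derivative T) (at z) \<and> (\<forall>v. norm (T v) \<le> 4 * spherical_deriv f z * norm v)"
    if z: "z \<in> S" for z
  proof -
    obtain V h I where V: "open V" "z \<in> V" "h holomorphic_on V" and I: "I = id \<or> I = sphere_inv"
      and h: "\<And>w. w \<in> V \<Longrightarrow> sphere_val f w = I (Some (h w))"
       "\<And>w. w \<in> V \<Longrightarrow> spherical_deriv f w = cmod (deriv h w) / (1 + (cmod (h w))\<^sup>2)"
      using nicely_meromorphic_chart[OF f S(1) z] by metis
    have "(h has_field_derivative deriv h z) (at z)"
      using V by (intro holomorphic_derivI) auto
    from has_derivative_riemann_point[OF this] obtain T
      where T: "((\<lambda>w. riemann_point (Some (h w))) has_derivative T) (at z)"
         "\<And>v. norm (T v) \<le> 4 * spherical_deriv f z * norm v"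
      using h(2)[OF V(2)] by metis
    show ?thesis using I
    proof
      assume "I = id"
      hence "(?F has_derivative T) (at z)"
        using h by (intro has_derivative_transform_within_open[OF T(1) V(1,2)]) auto
      thus ?thesis using T(2) by blast
    next
      assume "I = sphere_inv"
      \<comment> \<open>The linear part of \<open>sphere_flip\<close> applied to \<open>T\<close>,
        which preserves norms.\<close>
      let ?T = "\<lambda>v. (cnj (fst (T v)), - snd (T v))"
      have "((\<lambda>w. sphere_flip (riemann_point (Some (h w)))) has_derivative ?T) (at z)"
        unfolding sphere_flip_def by (rule derivative_eq_intros T(1) refl | simp)+
      hence "(?F has_derivative ?T) (at z)"
        using h \<open>I = sphere_inv\<close>
        by (rule_tac has_derivative_transform_within_open[OF _ V(1,2)]) (auto simp: riemann_point_sphere_inv)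
      moreover have "norm (?T v) \<le> 4 * spherical_deriv f z * norm v" for v
        using T(2)[of v] by (simp add: norm_prod_def)
      ultimately show ?thesis by (intro exI[of _ ?T]) blast
    qed
  qed
  hence "\<exists>T. \<forall>z\<in>S. (?F has_derivative T z) (at z) \<and> (\<forall>v. norm (T z v) \<le> 4 * spherical_deriv f z * norm v)"
    by (intro bchoice) blast
  then obtain T where T: "\<And>z. z \<in> S \<Longrightarrow> (?F has_derivative T z) (at z)"
      "\<And>z v. z \<in> S \<Longrightarrow> norm (T z v) \<le> 4 * spherical_deriv f z * norm v" by blast
  have "norm (?F x - ?F y) \<le> 4 * B * norm (x - y)"
  proof (rule differentiable_bound[OF S(2) _ _ xy])
    show "(?F has_derivative T z) (at z within S)" if "z \<in> S" for z
      using T(1)[OF that] has_derivative_at_withinI by blast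
    show "onorm (T z) \<le> 4 * B" if "z \<in> S" for z
    proof (rule onorm_le)
      fix v show "norm (T z v) \<le> 4 * B * norm v"
        using T(2)[OF that, of v] mult_right_mono[of "4 * spherical_deriv f z" "4 * B" "norm v"] B[OF that] by simp
    qed
  qed
  thus ?thesis by (simp add: dist_norm)
qed

section \<open>Choice of the rescaling points\<close>

text \<open>The potential is three times the tail integral from \<open>t / 2\<close>. Halving the argument allows
  \<open>\<phi>\<close> to be compared with its value at the right end point \<open>L\<close> of the range of integration,
  although \<open>\<phi>\<close> may grow fast beyond \<open>L\<close>.\<close>

lemma tail_potential:
  fixes \<phi> :: "real \<Rightarrow> real"
  assumes "t\<^sub>0 > 0" and pos: "\<And>t. t \<ge> t\<^sub>0 \<Longrightarrow> \<phi> t > 0" and mono: "mono_on {t\<^sub>0..} \<phi>"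
    and int: "(\<lambda>t. 1 / (t * \<phi> t)) integrable_on {t\<^sub>0..}"
  obtains H where "continuous_on {2 * t\<^sub>0..} H" "antimono_on {2 * t\<^sub>0..} H" "(H \<longlongrightarrow> 0) at_top"
    "\<And>L x. L \<ge> 2 * t\<^sub>0 \<Longrightarrow> 0 < x \<Longrightarrow> x \<le> 1 \<Longrightarrow> H (L * (1 + x)) + x / \<phi> L < H L"
    "\<And>L. L \<ge> 2 * t\<^sub>0 \<Longrightarrow> 1 / \<phi> L \<le> H L"
proof -
  define \<psi> where "\<psi> = (\<lambda>t. 1 / (t * \<phi> t))"
  define I where "I = (\<lambda>t. integral {t\<^sub>0..t} \<psi>)"
  \<comment> \<open>As \<open>\<psi>\<close> is nonnegative, this supremum is its integral over the
    whole half-line.\<close>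
  define J where "J = Sup (I ` {t\<^sub>0..})"
  \<comment> \<open>Both inequalities below would already hold in weak form with the factor 2; the
    factor 3 makes the drop strict.\<close>
  define H where "H = (\<lambda>t. 3 * (J - I (t / 2)))"
  have \<psi>_anti: "\<psi> t \<le> \<psi> s" if "t\<^sub>0 \<le> s" "s \<le> t" for s t
  proof -
    have "s * \<phi> s \<le> t * \<phi> t"
      using that \<open>t\<^sub>0 > 0\<close> mono_onD[OF mono, of s t] pos[of s] by (intro mult_mono) auto
    moreover have "0 < s * \<phi> s" using that \<open>t\<^sub>0 > 0\<close> pos[of s] by simp
    ultimately show ?thesis by (simp add: \<psi>_def frac_le)
  qed
  have \<psi>_pos: "0 \<le> \<psi> t" if "t\<^sub>0 \<le> t" for t
    using that \<open>t\<^sub>0 > 0\<close> pos[of t] by (simp add: \<psi>_def)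
  have \<psi>_int: "\<psi> integrable_on {s..t}" if "t\<^sub>0 \<le> s" for s t
    using integrable_on_subinterval[OF int, of s t] that by (auto simp: \<psi>_def)
  have I_diff: "(t - s) * \<psi> t \<le> I t - I s" if "t\<^sub>0 \<le> s" "s \<le> t" for s t
  proof -
    have "I s + integral {s..t} \<psi> = I t"
      unfolding I_def using that by (intro Henstock_Kurzweil_Integration.integral_combine \<psi>_int) auto
    moreover have "integral {s..t} (\<lambda>_. \<psi> t) \<le> integral {s..t} \<psi>"
      using that \<psi>_anti by (intro integral_le \<psi>_int) auto
    ultimately show ?thesis using that by simp
  qed
  have I_mono: "I s \<le> I t" if "t\<^sub>0 \<le> s" "s \<le> t" for s t
    using I_diff[OF that] \<psi>_pos[of t] that mult_nonneg_nonneg[of "t - s" "\<psi> t"] by linarith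
  have bdd: "bdd_above (I ` {t\<^sub>0..})"
  proof (rule bdd_aboveI2)
    fix t assume "t \<in> {t\<^sub>0..}"
    show "I t \<le> integral {t\<^sub>0..} \<psi>"
      unfolding I_def using \<psi>_int int \<psi>_pos by (intro integral_subset_le) (auto simp: \<psi>_def)
  qed
  have IJ: "I t \<le> J" if "t\<^sub>0 \<le> t" for t
    unfolding J_def using bdd that by (intro cSUP_upper) auto
  show ?thesis
  proof
    have I_cont: "continuous_on {t\<^sub>0..b} I" for b
      unfolding I_def by (rule indefinite_integral_continuous_1) (simp add: \<psi>_int)
    \<comment> \<open>Continuity is local, so a bounded interval reaching beyond the point
      suffices.\<close>
    have "continuous_on {t\<^sub>0..} I"
    proof (rule continuous_on_eq_continuous_within[THEN iffD2], rule ballI)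
      fix t assume t: "t \<in> {t\<^sub>0..}"
      have "continuous (at t within {t\<^sub>0..t + 1}) I"
        using t I_cont[of "t + 1"] by (simp add: continuous_on_eq_continuous_within)
      moreover have "at t within {t\<^sub>0..t + 1} = at t within {t\<^sub>0..}"
        by (rule at_within_nhd[of t "{t - 1<..<t + 1}"]) auto
      ultimately show "continuous (at t within {t\<^sub>0..}) I" by simp
    qed
    hence "continuous_on {2 * t\<^sub>0..} (\<lambda>t. I (t / 2))"
      by (rule continuous_on_compose2) (auto intro!: continuous_intros)
    thus "continuous_on {2 * t\<^sub>0..} H"
      unfolding H_def by (intro continuous_intros)
    show "antimono_on {2 * t\<^sub>0..} H"
      unfolding H_def by (intro monotone_onI) (auto intro: I_mono)
    show "(H \<longlongrightarrow> 0) at_top"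
    proof (rule order_tendstoI)
      fix e :: real assume "e > 0"
      hence "J - e / 3 < J" by simp
      then obtain s where s: "s \<ge> t\<^sub>0" "J - e / 3 < I s"
        unfolding J_def using bdd by (subst (asm) less_cSUP_iff) auto
      have "H t < e" if "t \<ge> 2 * s" for t
        using s I_mono[of s "t / 2"] that by (simp add: H_def)
      thus "eventually (\<lambda>t. H t < e) at_top"
        using eventually_at_top_linorder by blast
    next
      fix e :: real assume "e < 0"
      have "H t > e" if "t \<ge> 2 * t\<^sub>0" for t
        using IJ[of "t / 2"] that \<open>e < 0\<close> by (simp add: H_def)
      thus "eventually (\<lambda>t. H t > e) at_top"
        using eventually_at_top_linorder by blast
    qed
    fix L assume L: "L \<ge> 2 * t\<^sub>0"
    have \<phi>L: "\<phi> L > 0" "L > 0" using pos[of L] L \<open>t\<^sub>0 > 0\<close> by auto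
    show "H (L * (1 + x)) + x / \<phi> L < H L" if x: "0 < x" "x \<le> 1" for x
    proof -
      let ?t = "L * (1 + x) / 2"
      \<comment> \<open>This is where \<open>x \<le> 1\<close> enters: the integration runs over a
        part of \<open>{L / 2..L}\<close>, on which \<open>\<psi>\<close> is at least
        \<open>\<psi> L\<close>.\<close>
      have t: "L / 2 \<le> ?t" "?t \<le> L" using x \<phi>L by auto
      have "t\<^sub>0 \<le> ?t" using t(1) L by linarith
      moreover have "?t - L / 2 = x * L / 2" by (simp add: algebra_simps)
      moreover have "0 \<le> x * L / 2" using x \<phi>L by simp
      ultimately have "x * L / 2 * \<psi> L \<le> (?t - L / 2) * \<psi> ?t"
        using t(2) x \<phi>L \<psi>_anti[of ?t L] by (simp only: mult_left_mono)
      also have "\<dots> \<le> I ?t - I (L / 2)"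
        using t L by (intro I_diff) auto
      finally have "x / (2 * \<phi> L) \<le> I ?t - I (L / 2)"
        using \<phi>L by (simp add: \<psi>_def)
      moreover have "0 < x / \<phi> L" using x \<phi>L by simp
      ultimately show ?thesis by (simp add: H_def)
    qed
    show "1 / \<phi> L \<le> H L"
    proof -
      have "(L - L / 2) * \<psi> L \<le> I L - I (L / 2)"
        using L \<phi>L by (intro I_diff) auto
      also have "\<dots> \<le> J - I (L / 2)" using IJ[of L] L \<open>t\<^sub>0 > 0\<close> by simp
      finally have "2 * ((L - L / 2) * \<psi> L) \<le> H L"
        using I_mono[of "L / 2" L] IJ[of L] L \<open>t\<^sub>0 > 0\<close> by (simp add: H_def)
      moreover have "2 * ((L - L / 2) * \<psi> L) = 1 / \<phi> L" using \<phi>L by (simp add: \<psi>_def)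
      ultimately show ?thesis by simp
    qed
  qed
qed

text \<open>The point is a minimiser of \<open>\<zeta> \<mapsto> dist \<zeta> a + H (M \<zeta>)\<close>.\<close>

lemma point_picking:
  fixes M :: "'a::heine_borel \<Rightarrow> real"
  assumes M: "continuous_on (cball a s) M"
    and H: "continuous_on {T..} H" "antimono_on {T..} H"
    and drop: "\<And>L x. L \<ge> T \<Longrightarrow> 0 < x \<Longrightarrow> x \<le> 1 \<Longrightarrow> H (L * (1 + x)) + x / \<phi> L < H L"
    and \<phi>: "\<And>L. L \<ge> T \<Longrightarrow> \<phi> L > 0" "\<And>L. L \<ge> T \<Longrightarrow> 1 / \<phi> L \<le> H L"
    and "T \<ge> 0" "M a \<ge> T" "2 * H (M a) \<le> s"
  obtains \<zeta> where "dist \<zeta> a \<le> H (M a)" "M \<zeta> \<ge> M a" "ball \<zeta> (1 / \<phi> (M \<zeta>)) \<subseteq> cball a s"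
    "\<And>w. dist w \<zeta> < 1 / \<phi> (M \<zeta>) \<Longrightarrow> M w \<le> M \<zeta> * (1 + \<phi> (M \<zeta>) * dist w \<zeta>)"
proof -
  \<comment> \<open>On \<open>S\<close> the values of \<open>M\<close> stay in the range where
    \<open>H\<close> is continuous and decreasing.\<close>
  define S where "S = {z \<in> cball a s. M z \<ge> M a}"
  have Ha: "0 < H (M a)" using \<phi>[OF \<open>M a \<ge> T\<close>] by (smt (verit) divide_pos_pos)
  have "S = cball a s \<inter> M -` {M a..}" by (auto simp: S_def)
  hence "closed S" using continuous_closed_preimage[OF M closed_cball closed_atLeast] by simp
  moreover have "S \<subseteq> cball a s" by (auto simp: S_def)
  ultimately have cS: "compact S" by (meson bounded_cball bounded_subset compact_eq_bounded_closed)
  have neS: "S \<noteq> {}" using Ha \<open>2 * H (M a) \<le> s\<close> by (auto simp: S_def intro!: exI[of _ a])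
  have "continuous_on S (\<lambda>z. dist z a + H (M z))"
    using \<open>M a \<ge> T\<close> by (intro continuous_intros continuous_on_compose2[OF H(1)] continuous_on_subset[OF M])
      (auto simp: S_def)
  from continuous_attains_inf[OF cS neS this] obtain \<zeta> where \<zeta>: "\<zeta> \<in> S"
    and min: "\<And>w. w \<in> S \<Longrightarrow> dist \<zeta> a + H (M \<zeta>) \<le> dist w a + H (M w)"
    by blast
  let ?L = "M \<zeta>"
  have L: "?L \<ge> M a" "?L \<ge> T" using \<zeta> \<open>M a \<ge> T\<close> by (auto simp: S_def)
  have pL: "\<phi> ?L > 0" "1 / \<phi> ?L \<le> H ?L" using \<phi> L by auto
  have "a \<in> S" using Ha \<open>2 * H (M a) \<le> s\<close> by (auto simp: S_def)
  \<comment> \<open>Comparison with the starting point \<open>a\<close> controls both the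
    displacement of the minimiser and the radius \<open>1 / \<phi> ?L \<le> H ?L\<close> around
    it.\<close>
  from min[OF this] have d: "dist \<zeta> a + H ?L \<le> H (M a)" by simp
  show ?thesis
  proof
    have "0 < 1 / \<phi> ?L" using pL by simp
    thus "dist \<zeta> a \<le> H (M a)" using d pL(2) by linarith
    show "M \<zeta> \<ge> M a" by fact
    show sub: "ball \<zeta> (1 / \<phi> ?L) \<subseteq> cball a s"
    proof
      fix w assume "w \<in> ball \<zeta> (1 / \<phi> ?L)"
      hence "dist \<zeta> w < H ?L" using pL by simp
      with d have "dist a w \<le> H (M a)" using dist_triangle[of a w \<zeta>] by (simp add: dist_commute)
      thus "w \<in> cball a s" using \<open>2 * H (M a) \<le> s\<close> Ha by simp
    qed
    fix w assume w: "dist w \<zeta> < 1 / \<phi> ?L"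
    let ?x = "\<phi> ?L * dist w \<zeta>"
    show "M w \<le> ?L * (1 + ?x)"
    proof (rule ccontr)
      \<comment> \<open>Moving from \<open>\<zeta>\<close> to \<open>w\<close> would cost at most
        \<open>dist w \<zeta> = ?x / \<phi> ?L\<close>, while \<open>H\<close> would drop by more
        than that, contradicting minimality.\<close>
      assume "\<not> ?thesis"
      hence Mw: "M w > ?L * (1 + ?x)" by simp
      have "dist w \<zeta> \<noteq> 0" using Mw by auto
      hence x: "0 < ?x" "?x \<le> 1" using w pL by (auto simp: field_simps)
      have Lx: "?L \<le> ?L * (1 + ?x)" using x L \<open>T \<ge> 0\<close> by (simp add: mult_le_cancel_left1)
      hence "w \<in> S" using Mw L w sub by (auto simp: S_def dist_commute subset_iff)
      from min[OF this] have "H ?L \<le> dist w \<zeta> + H (M w)"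
        using dist_triangle[of w a \<zeta>] by linarith
      also have "H (M w) \<le> H (?L * (1 + ?x))"
        using monotone_onD[OF H(2), of "?L * (1 + ?x)" "M w"] Mw Lx L by simp
      finally show False using drop[OF L(2) x] pL by simp
    qed
  qed
qed

section \<open>Marty's criterion\<close>

text \<open>The equation |x|^2 + t^2 = t describes the sphere; every point with t \<noteq> 1 comes
  from x / (1 - t). As an equation between continuous functions it shows that the image is closed,
  so limits of projected values are again values on the sphere.\<close>

lemma range_riemann_point: "range riemann_point = {p. fst p \<bullet> fst p + snd p * snd p = snd p}"
proof (intro equalityI subsetI)
  fix p assume "p \<in> range riemann_point"
  then obtain q where q: "p = riemann_point q" by blast
  show "p \<in> {p. fst p \<bullet> fst p + snd p * snd p = snd p}"
  proof (cases q)
    case (Some a)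
    have "(a \<bullet> a) / A\<^sup>2 + (a \<bullet> a / A)\<^sup>2 = a \<bullet> a / A" if "A = 1 + a \<bullet> a" "A \<noteq> 0" for A
      using that(2) by (simp add: divide_simps power2_eq_square) (simp add: that(1) algebra_simps)
    from this[of "1 + a \<bullet> a"] show ?thesis
      by (simp add: q Some riemann_point_def power2_eq_square divide_inverse mult_ac)
  qed (simp add: q riemann_point_def)
next
  fix p :: "complex \<times> real" assume "p \<in> {p. fst p \<bullet> fst p + snd p * snd p = snd p}"
  then obtain x t where p: "p = (x, t)" and xt: "x \<bullet> x + t * t = t" by (cases p) auto
  show "p \<in> range riemann_point"
  proof (cases "t = 1")
    case True
    hence "p = riemann_point None" using xt p by (simp add: riemann_point_def)
    thus ?thesis by blast
  next
    case False
    let ?a = "x /\<^sub>R (1 - t)"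
    have "x \<bullet> x = t - t * t" using xt by linarith
    hence "?a \<bullet> ?a = (t - t * t) / (1 - t)\<^sup>2"
      by (simp add: power2_eq_square divide_inverse)
    also have "\<dots> = t / (1 - t)" using False by (simp add: divide_simps power2_eq_square) algebra
    finally have *: "?a \<bullet> ?a = t / (1 - t)" .
    have "1 + ?a \<bullet> ?a = inverse (1 - t)" using False unfolding * by (simp add: divide_simps)
    hence "p = riemann_point (Some ?a)"
      using False * p by (simp add: riemann_point_def)
    thus ?thesis by blast
  qed
qed

lemma closed_range_riemann_point: "closed (range riemann_point)"
  unfolding range_riemann_point by (intro closed_Collect_eq continuous_intros)

lemma spherical_loc_uniform_limitI:
  assumes "\<And>z. z \<in> U \<Longrightarrow> \<exists>V. open V \<and> z \<in> V \<and> V \<subseteq> U \<and>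
    uniform_limit V (\<lambda>n x. riemann_point (F n x)) (\<lambda>x. riemann_point (G x)) sequentially"
  shows "spherical_loc_uniform_limit U F G"
  unfolding spherical_loc_uniform_limit_def
proof
  fix z assume "z \<in> U"
  then obtain V where V: "open V" "z \<in> V" "V \<subseteq> U"
    "uniform_limit V (\<lambda>n x. riemann_point (F n x)) (\<lambda>x. riemann_point (G x)) sequentially"
    using assms by blast
  have "\<forall>\<^sub>F n in sequentially. \<forall>w\<in>V. spherical_dist (F n w) (G w) < e" if "e > 0" for e
  proof -
    obtain d where d: "d > 0" "\<And>p q. dist (riemann_point p) (riemann_point q) < d \<Longrightarrow> spherical_dist p q < e"
      using spherical_dist_less[OF \<open>e > 0\<close>] by metis
    from uniform_limitD[OF V(4) d(1)] show ?thesis by eventually_elim (use d(2) in blast)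
  qed
  with V(1-3) show "\<exists>V. open V \<and> z \<in> V \<and> V \<subseteq> U \<and>
      (\<forall>e>0. \<forall>\<^sub>F n in sequentially. \<forall>w\<in>V. spherical_dist (F n w) (G w) < e)" by blast
qed

text \<open>Arzela--Ascoli on each \<open>K i\<close>, followed by a diagonal subsequence. The
  thresholds \<open>N i\<close> are there because rescaled functions are controlled on a given disc
  only from some index on.\<close>

lemma eventually_equi_lipschitz_convergent_subsequence:
  fixes F :: "nat \<Rightarrow> complex \<Rightarrow> complex option" and K :: "nat \<Rightarrow> complex set"
  assumes K: "\<And>i. compact (K i)"
    and lip: "\<And>i n x y. n \<ge> N i \<Longrightarrow> x \<in> K i \<Longrightarrow> y \<in> K i \<Longrightarrow>
      dist (riemann_point (F n x)) (riemann_point (F n y)) \<le> C i * dist x y"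
  obtains k G where "strict_mono (k :: nat \<Rightarrow> nat)"
    "\<And>i. uniform_limit (K i) (\<lambda>n x. riemann_point (F (k n) x)) (\<lambda>x. riemann_point (G x)) sequentially"
proof -
  \<comment> \<open>Early terms are replaced by a constant, so that equicontinuity on
    \<open>K i\<close> holds for all indices.\<close>
  define F' where "F' = (\<lambda>i n x. if n \<ge> N i then riemann_point (F n x) else 0)"
  define P where "P = (\<lambda>i (s :: nat \<Rightarrow> nat). \<exists>g. uniform_limit (K i) (\<lambda>n. F' i (s n)) g sequentially)"
  obtain k where k: "strict_mono (k :: nat \<Rightarrow> nat)" "\<And>i. P i (id \<circ> k)"
  proof (rule subsequence_diagonalization_lemma[of P id])
    fix i and r :: "nat \<Rightarrow> nat"
    have C: "0 < max (C i) 1" by simp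
    obtain g k where gk: "strict_mono (k :: nat \<Rightarrow> nat)"
      "\<And>e. 0 < e \<Longrightarrow> \<exists>M. \<forall>n x. n \<ge> M \<and> x \<in> K i \<longrightarrow> norm (F' i (r (k n)) x - g x) < e"
    proof (rule Arzela_Ascoli[OF K, of i "\<lambda>n. F' i (r n)" 1])
      show "norm (F' i (r n) x) \<le> 1" for n x
        by (simp add: F'_def norm_riemann_point_le)
      fix x and e :: real assume x: "x \<in> K i" and "e > 0"
      have "norm (F' i (r n) x - F' i (r n) y) < e" if "y \<in> K i" "norm (x - y) < e / max (C i) 1" for n y
      proof -
        have "norm (F' i (r n) x - F' i (r n) y) \<le> max (C i) 1 * norm (x - y)"
          using lip[of i "r n" x y] x that(1) mult_right_mono[of "C i" "max (C i) 1" "norm (x - y)"]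
          by (auto simp: F'_def dist_norm)
        also have "\<dots> < e" using that(2) C by (simp add: pos_less_divide_eq mult.commute)
        finally show ?thesis .
      qed
      thus "\<exists>d>0. \<forall>n y. y \<in> K i \<and> norm (x - y) < d \<longrightarrow> norm (F' i (r n) x - F' i (r n) y) < e"
        using \<open>e > 0\<close> C by (intro exI[of _ "e / max (C i) 1"]) auto
    qed auto
    have "uniform_limit (K i) (\<lambda>n. F' i (r (k n))) g sequentially"
      unfolding uniform_limit_sequentially_iff dist_norm using gk(2) by blast
    with gk(1) show "\<exists>k. strict_mono k \<and> P i (r \<circ> k)"
      unfolding P_def o_def by blast
  next
    fix i and r k1 k2 :: "nat \<Rightarrow> nat" and N
    assume "P i (r \<circ> k1)" and sub: "\<And>j. N \<le> j \<Longrightarrow> \<exists>j'. j \<le> j' \<and> k2 j = k1 j'"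
    then obtain g where g: "uniform_limit (K i) (\<lambda>n. F' i (r (k1 n))) g sequentially"
      by (auto simp: P_def)
    \<comment> \<open>From \<open>N\<close> on, each term of \<open>k2\<close> is a term of
      \<open>k1\<close> with an index at least as large.\<close>
    have "uniform_limit (K i) (\<lambda>n. F' i (r (k2 n))) g sequentially"
      unfolding uniform_limit_sequentially_iff
    proof (intro allI impI)
      fix e :: real assume "e > 0"
      then obtain M where M: "\<And>n x. n \<ge> M \<Longrightarrow> x \<in> K i \<Longrightarrow> dist (F' i (r (k1 n)) x) (g x) < e"
        using g unfolding uniform_limit_sequentially_iff by blast
      have "dist (F' i (r (k2 n)) x) (g x) < e" if "n \<ge> max M N" "x \<in> K i" for n x
        using sub[of n] M that by fastforce
      thus "\<exists>M. \<forall>n\<ge>M. \<forall>x\<in>K i. dist (F' i (r (k2 n)) x) (g x) < e" by blast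
    qed
    thus "P i (r \<circ> k2)" by (auto simp: P_def)
  qed (rule that)
  have "\<exists>g. uniform_limit (K i) (\<lambda>n x. riemann_point (F (k n) x)) g sequentially" for i
  proof -
    obtain g where g: "uniform_limit (K i) (\<lambda>n. F' i (k n)) g sequentially"
      using k(2)[of i] by (auto simp: P_def)
    have "\<forall>\<^sub>F n in sequentially. \<forall>x\<in>K i. F' i (k n) x = riemann_point (F (k n) x)"
      using eventually_ge_at_top[of "N i"]
      by eventually_elim (use seq_suble[OF k(1)] in \<open>auto simp: F'_def dest: order_trans\<close>)
    with g show ?thesis by (auto cong: uniform_limit_cong)
  qed
  then obtain g where g: "\<And>i. uniform_limit (K i) (\<lambda>n x. riemann_point (F (k n) x)) (g i) sequentially"
    by metis
  \<comment> \<open>Defined by the pointwise limit, hence independent of \<open>i\<close>; this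
    makes the limits on different \<open>K i\<close> compatible.\<close>
  define G where "G = (\<lambda>x. SOME p. (\<lambda>n. riemann_point (F (k n) x)) \<longlonglongrightarrow> riemann_point p)"
  have "g i x = riemann_point (G x)" if "x \<in> K i" for i x
  proof -
    have lim: "(\<lambda>n. riemann_point (F (k n) x)) \<longlonglongrightarrow> g i x" by (rule tendsto_uniform_limitI[OF g that])
    have "g i x \<in> range riemann_point"
      by (rule closed_sequentially[OF closed_range_riemann_point _ lim]) auto
    with lim have "\<exists>p. (\<lambda>n. riemann_point (F (k n) x)) \<longlonglongrightarrow> riemann_point p" by auto
    hence "(\<lambda>n. riemann_point (F (k n) x)) \<longlonglongrightarrow> riemann_point (G x)" unfolding G_def by (rule someI_ex)
    with lim show ?thesis using LIMSEQ_unique by blast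
  qed
  with g have "uniform_limit (K i) (\<lambda>n x. riemann_point (F (k n) x)) (\<lambda>x. riemann_point (G x)) sequentially" for i
    by (metis (mono_tags, lifting) uniform_limit_cong')
  with k(1) show ?thesis by (rule that)
qed

text \<open>Its contrapositive supplies the points of large spherical derivative. The radius is
  halved to have a compact disc for Arzela--Ascoli.\<close>

lemma normal_at_if_spherical_deriv_bounded:
  assumes "r > 0" and r: "ball z\<^sub>0 r \<subseteq> D"
    and mero: "\<And>f. f \<in> \<F> \<Longrightarrow> f nicely_meromorphic_on D"
    and B: "\<And>f z. f \<in> \<F> \<Longrightarrow> z \<in> ball z\<^sub>0 r \<Longrightarrow> spherical_deriv f z \<le> B"
  shows "normal_at D \<F> z\<^sub>0"
  unfolding normal_at_def
proof (intro exI[of _ "ball z\<^sub>0 (r / 2)"] conjI allI impI)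
  fix f :: "nat \<Rightarrow> complex \<Rightarrow> complex" assume f: "range f \<subseteq> \<F>"
  have sub: "cball z\<^sub>0 (r / 2) \<subseteq> ball z\<^sub>0 r" using \<open>r > 0\<close> by auto
  have lip: "dist (riemann_point (sphere_val (f n) x)) (riemann_point (sphere_val (f n) y)) \<le> 4 * B * dist x y"
    if "x \<in> cball z\<^sub>0 (r / 2)" "y \<in> cball z\<^sub>0 (r / 2)" for n x y
  proof (rule spherical_deriv_lipschitz[of _ "ball z\<^sub>0 r"])
    have fn: "f n \<in> \<F>" using f by blast
    show "f n nicely_meromorphic_on ball z\<^sub>0 r"
      by (rule nicely_meromorphic_on_subset[OF mero[OF fn] r])
    show "spherical_deriv (f n) z \<le> B" if "z \<in> ball z\<^sub>0 r" for z by (rule B[OF fn that])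
  qed (use that sub in auto)
  obtain k G where "strict_mono (k :: nat \<Rightarrow> nat)" and
    lim: "uniform_limit (cball z\<^sub>0 (r / 2)) (\<lambda>n x. riemann_point (sphere_val (f (k n)) x)) (\<lambda>x. riemann_point (G x)) sequentially"
    using eventually_equi_lipschitz_convergent_subsequence[of "\<lambda>_. cball z\<^sub>0 (r / 2)" "\<lambda>_. 0"
       "\<lambda>n. sphere_val (f n)" "\<lambda>_. 4 * B"] lip compact_cball by metis
  moreover have "spherical_loc_uniform_limit (ball z\<^sub>0 (r / 2)) (\<lambda>n. sphere_val (f (k n))) G"
    using uniform_limit_on_subset[OF lim, of "ball z\<^sub>0 (r / 2)"]
    by (intro spherical_loc_uniform_limitI exI[of _ "ball z\<^sub>0 (r / 2)"]) auto
  ultimately show "\<exists>k G. strict_mono k \<and>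
      spherical_loc_uniform_limit (ball z\<^sub>0 (r / 2)) (\<lambda>n. sphere_val (f (k n))) G" by blast
qed (use \<open>r > 0\<close> r in auto)

section \<open>Meromorphic limits\<close>

text \<open>The height |a|^2 / (1 + |a|^2) increases with |a|. Bounded height is how boundedness of
  a chart function is read off from the sphere.\<close>

lemma snd_riemann_point_le_iff: "snd (riemann_point (Some a)) \<le> 9 / 10 \<longleftrightarrow> cmod a \<le> 3"
proof -
  have "snd (riemann_point (Some a)) \<le> 9 / 10 \<longleftrightarrow> a \<bullet> a \<le> 9"
    using one_plus_inner_pos[of a] by (simp add: riemann_point_def pos_divide_le_eq)
  also have "\<dots> \<longleftrightarrow> (cmod a)\<^sup>2 \<le> 3\<^sup>2" by (simp add: dot_square_norm)
  also have "\<dots> \<longleftrightarrow> cmod a \<le> 3" by (subst abs_le_square_iff[symmetric]) simp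
  finally show ?thesis .
qed

text \<open>On the disc of radius 3 chordal and Euclidean distance are comparable, so the
  convergence is uniform in the plane, and Weierstrass' theorem gives convergence of the derivatives
  on a smaller disc.\<close>

lemma bounded_holomorphic_spherical_limit:
  assumes "r > 0"
    and ev: "\<forall>\<^sub>F n in sequentially. h n holomorphic_on ball z r \<and> (\<forall>w\<in>ball z r. cmod (h n w) \<le> 3)"
    and lim: "uniform_limit (ball z r) (\<lambda>n w. riemann_point (Some (h n w))) (\<lambda>w. riemann_point (K w)) sequentially"
  obtains g where "g holomorphic_on ball z (r / 2)" "\<And>w. w \<in> ball z (r / 2) \<Longrightarrow> K w = Some (g w)"
    "\<And>w. w \<in> ball z (r / 2) \<Longrightarrow> (\<lambda>n. cmod (deriv (h n) w) / (1 + (cmod (h n w))\<^sup>2))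
         \<longlonglongrightarrow> cmod (deriv g w) / (1 + (cmod (g w))\<^sup>2)"
proof -
  define g where "g = (\<lambda>w. the (K w))"
  have g: "K w = Some (g w)" "cmod (g w) \<le> 3" if w: "w \<in> ball z r" for w
  proof -
    have "(\<lambda>n. snd (riemann_point (Some (h n w)))) \<longlonglongrightarrow> snd (riemann_point (K w))"
      by (intro tendsto_snd tendsto_uniform_limitI[OF lim w])
    moreover have "\<forall>\<^sub>F n in sequentially. snd (riemann_point (Some (h n w))) \<le> 9 / 10"
      using ev by eventually_elim (use w in \<open>simp only: snd_riemann_point_le_iff\<close>)
    ultimately have *: "snd (riemann_point (K w)) \<le> 9 / 10"
      using tendsto_upperbound trivial_limit_sequentially by blast
    \<comment> \<open>Infinity has height 1.\<close>
    hence "K w \<noteq> None" by (intro notI) (simp add: riemann_point_def)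
    thus "K w = Some (g w)" by (simp add: g_def)
    with * show "cmod (g w) \<le> 3" by (simp only: snd_riemann_point_le_iff)
  qed
  have ulim: "uniform_limit (ball z r) h g sequentially"
  proof (rule uniform_limitI)
    fix e :: real assume "e > 0"
    \<comment> \<open>Each square root in the denominator of the chordal distance is at most sqrt
      10, because 1 + 3^2 = 10.\<close>
    hence "e / 10 > 0" by simp
    from uniform_limitD[OF lim this] ev show "\<forall>\<^sub>F n in sequentially. \<forall>w\<in>ball z r. dist (h n w) (g w) < e"
    proof eventually_elim
      case (elim n)
      show ?case
      proof
        fix w assume w: "w \<in> ball z r"
        have sq: "0 < sqrt (1 + (cmod a)\<^sup>2)" "sqrt (1 + (cmod a)\<^sup>2) \<le> sqrt 10" if "cmod a \<le> 3" for a
          using that power_mono[of "cmod a" 3 2] by (auto simp: add_pos_nonneg)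
        let ?c = "sqrt (1 + (cmod (h n w))\<^sup>2) * sqrt (1 + (cmod (g w))\<^sup>2)"
        have hw: "cmod (h n w) \<le> 3" using elim w by blast
        have c: "0 < ?c" "?c \<le> sqrt 10 * sqrt 10"
          using sq(1)[OF hw] sq(1)[OF g(2)[OF w]]
            mult_mono[OF sq(2)[OF hw] sq(2)[OF g(2)[OF w]]] by simp_all
        have "chordal_dist (Some (h n w)) (Some (g w)) < e / 10"
          using elim w g(1)[OF w] by (metis dist_riemann_point)
        hence "cmod (h n w - g w) < e / 10 * ?c"
          using c(1) by (simp add: pos_divide_less_eq)
        also have "\<dots> \<le> e / 10 * (sqrt 10 * sqrt 10)"
          using c(2) \<open>e > 0\<close> by (intro mult_left_mono) auto
        finally show "dist (h n w) (g w) < e" by (simp add: dist_norm)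
      qed
    qed
  qed
  have sub: "cball z (r / 2) \<subseteq> ball z r" "ball z (r / 2) \<subseteq> ball z r" using \<open>r > 0\<close> by auto
  have cont: "\<forall>\<^sub>F n in sequentially. continuous_on (cball z (r / 2)) (h n) \<and>
          (\<forall>w \<in> ball z (r / 2). (h n has_field_derivative deriv (h n) w) (at w))"
    using ev
  proof eventually_elim
    case (elim n)
    hence "h n holomorphic_on ball z r" by simp
    moreover from this have "continuous_on (cball z (r / 2)) (h n)"
      using sub holomorphic_on_imp_continuous_on continuous_on_subset by blast
    ultimately show ?case using sub by (auto intro!: holomorphic_derivI[of _ "ball z r"])
  qed
  have "0 < r / 2" using \<open>r > 0\<close> by simp
  from has_complex_derivative_uniform_limit[OF cont uniform_limit_on_subset[OF ulim sub(1)] trivial_limit_sequentially this]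
  obtain g' where g': "\<And>w. w \<in> ball z (r / 2) \<Longrightarrow>
      (g has_field_derivative g' w) (at w) \<and> (\<lambda>n. deriv (h n) w) \<longlonglongrightarrow> g' w"
    by metis
  show ?thesis
  proof
    show "g holomorphic_on ball z (r / 2)"
      using g' by (meson field_differentiable_at_within field_differentiable_def holomorphic_on_def)
    fix w assume w: "w \<in> ball z (r / 2)"
    show "K w = Some (g w)" using g(1) w sub by blast
    have "w \<in> ball z r" using w sub by blast
    have "deriv g w = g' w" using g'[OF w] DERIV_imp_deriv by blast
    thus "(\<lambda>n. cmod (deriv (h n) w) / (1 + (cmod (h n w))\<^sup>2))
         \<longlonglongrightarrow> cmod (deriv g w) / (1 + (cmod (g w))\<^sup>2)"
      using g'[OF w] tendsto_uniform_limitI[OF ulim \<open>w \<in> ball z r\<close>]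
      by (intro tendsto_intros) (auto simp: add_nonneg_eq_0_iff)
  qed
qed

text \<open>The chart is fixed by the hemisphere containing \<open>G z\<close>. Near
  \<open>z\<close> and for large \<open>n\<close> the values of \<open>f n\<close> stay away from
  infinity in this chart, so the chart functions are holomorphic and bounded.\<close>

lemma meromorphic_spherical_limit_chart:
  assumes "r > 0"
    and ev: "\<forall>\<^sub>F n in sequentially. f n nicely_meromorphic_on ball z r"
    and lim: "uniform_limit (ball z r) (\<lambda>n w. riemann_point (sphere_val (f n) w)) (\<lambda>w. riemann_point (G w)) sequentially"
    and cont: "isCont (\<lambda>w. riemann_point (G w)) z"
  obtains s g I where "s > 0" "I = id \<or> I = sphere_inv" "g holomorphic_on ball z s"
    "\<And>w. w \<in> ball z s \<Longrightarrow> G w = I (Some (g w))"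
    "\<And>w. w \<in> ball z s \<Longrightarrow> (\<lambda>n. spherical_deriv (f n) w) \<longlonglongrightarrow> cmod (deriv g w) / (1 + (cmod (g w))\<^sup>2)"
proof -
  define I where "I = (if snd (riemann_point (G z)) \<le> 1 / 2 then id else sphere_inv)"
  have I: "I = id \<or> I = sphere_inv" by (simp add: I_def)
  have II: "I (I p) = p" for p using I by auto
  have Id: "dist (riemann_point (I p)) (riemann_point (I q)) = dist (riemann_point p) (riemann_point q)" for p q
    using I by (auto simp: riemann_point_sphere_inv sphere_flip_isometry)
  have snd_le: "snd (riemann_point p) \<le> snd (riemann_point q) + dist (riemann_point p) (riemann_point q)" for p q
    using dist_snd_le[of "riemann_point p" "riemann_point q"] by (simp add: dist_real_def)
  have z: "snd (riemann_point (I (G z))) \<le> 1 / 2"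
    by (auto simp: I_def riemann_point_sphere_inv sphere_flip_def)
  \<comment> \<open>Heights add up: 1/2 at \<open>G z\<close>, 1/5 for moving to \<open>w\<close>
    and 1/5 for passing to \<open>f n\<close> give 9/10, that is, modulus at most 3.\<close>
  obtain d where d: "d > 0" "\<And>w. dist w z < d \<Longrightarrow> dist (riemann_point (G w)) (riemann_point (G z)) < 1 / 5"
    using cont unfolding continuous_at_eps_delta by (metis zero_less_divide_1_iff zero_less_numeral)
  define s where "s = min r d"
  have "s > 0" using d \<open>r > 0\<close> by (simp add: s_def)
  have sub: "ball z s \<subseteq> ball z r" by (auto simp: s_def)
  define h where "h = (\<lambda>n w. if I = id then f n w else inverse (f n w))"
  have ev_small: "\<forall>\<^sub>F n in sequentially. \<forall>w\<in>ball z s. snd (riemann_point (I (sphere_val (f n) w))) \<le> 9 / 10"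
    using uniform_limitD[OF lim, of "1 / 5", simplified]
  proof eventually_elim
    case (elim n)
    show ?case
    proof
      fix w assume w: "w \<in> ball z s"
      hence "dist (riemann_point (sphere_val (f n) w)) (riemann_point (G w)) < 1 / 5"
          "dist (riemann_point (G w)) (riemann_point (G z)) < 1 / 5"
        using elim d(2)[of w] sub by (auto simp: s_def dist_commute)
      with snd_le[of "I (sphere_val (f n) w)" "I (G w)"] snd_le[of "I (G w)" "I (G z)"] z
      show "snd (riemann_point (I (sphere_val (f n) w))) \<le> 9 / 10" unfolding Id by linarith
    qed
  qed
  have ev_h: "\<forall>\<^sub>F n in sequentially. h n holomorphic_on ball z s \<and>
      (\<forall>w\<in>ball z s. I (sphere_val (f n) w) = Some (h n w) \<and> cmod (h n w) \<le> 3 \<and>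
        spherical_deriv (f n) w = cmod (deriv (h n) w) / (1 + (cmod (h n w))\<^sup>2))"
    using ev_small ev
  proof eventually_elim
    case (elim n)
    have mero: "f n nicely_meromorphic_on ball z s"
      by (rule nicely_meromorphic_on_subset[OF elim(2) sub])
    have main: "h n holomorphic_on ball z s \<and> (\<forall>w\<in>ball z s. I (sphere_val (f n) w) = Some (h n w) \<and>
        spherical_deriv (f n) w = cmod (deriv (h n) w) / (1 + (cmod (h n w))\<^sup>2))"
    proof (cases "I = id")
      case True
      \<comment> \<open>A pole would have height 1. In the inverted chart the same argument excludes
        zeros.\<close>
      have "\<not> is_pole (f n) w" if "w \<in> ball z s" for w
        using elim(1) that True by (force simp: sphere_val_def riemann_point_def)
      hence a: "f n analytic_on ball z s" using mero nicely_meromorphic_without_singularities by blast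
      hence "f n analytic_on {w}" if "w \<in> ball z s" for w using that analytic_on_analytic_at by blast
      thus ?thesis
        using analytic_imp_holomorphic[OF a] sphere_val_analytic True by (simp add: h_def)
    next
      case False
      hence Iinv: "I = sphere_inv" using I by blast
      have "sphere_val (f n) w \<noteq> Some 0" if "w \<in> ball z s" for w
        using elim(1) that Iinv by (force simp: sphere_inv_def riemann_point_def)
      note rec = nicely_meromorphic_reciprocal[OF mero open_ball this]
      have hn: "h n = (\<lambda>w. inverse (f n w))" using False by (simp add: h_def)
      show ?thesis unfolding hn Iinv using rec by auto
    qed
    moreover have "cmod (h n w) \<le> 3" if "w \<in> ball z s" for w
    proof -
      have "I (sphere_val (f n) w) = Some (h n w)" using main that by blast
      with elim(1) that show ?thesis by (metis snd_riemann_point_le_iff)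
    qed
    ultimately show ?case by blast
  qed
  have lim_s: "uniform_limit (ball z s) (\<lambda>n w. riemann_point (Some (h n w))) (\<lambda>w. riemann_point (I (G w))) sequentially"
  proof (rule uniform_limitI)
    fix e :: real assume "e > 0"
    from uniform_limitD[OF lim this] ev_h
    show "\<forall>\<^sub>F n in sequentially. \<forall>w\<in>ball z s. dist (riemann_point (Some (h n w))) (riemann_point (I (G w))) < e"
    proof eventually_elim
      case (elim n)
      thus ?case using sub Id by (metis (no_types, lifting) subsetD)
    qed
  qed
  have ev_h': "\<forall>\<^sub>F n in sequentially. h n holomorphic_on ball z s \<and> (\<forall>w\<in>ball z s. cmod (h n w) \<le> 3)"
    using ev_h by eventually_elim blast
  obtain g where g: "g holomorphic_on ball z (s / 2)" "\<And>w. w \<in> ball z (s / 2) \<Longrightarrow> I (G w) = Some (g w)"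
    "\<And>w. w \<in> ball z (s / 2) \<Longrightarrow> (\<lambda>n. cmod (deriv (h n) w) / (1 + (cmod (h n w))\<^sup>2))
         \<longlonglongrightarrow> cmod (deriv g w) / (1 + (cmod (g w))\<^sup>2)"
    using bounded_holomorphic_spherical_limit[OF \<open>s > 0\<close> ev_h' lim_s] by blast
  show ?thesis
  proof
    show "0 < s / 2" using \<open>s > 0\<close> by simp
    show "I = id \<or> I = sphere_inv" by (fact I)
    show "g holomorphic_on ball z (s / 2)" by (fact g(1))
    fix w assume w: "w \<in> ball z (s / 2)"
    show "G w = I (Some (g w))" using g(2)[OF w] II by metis
    have "w \<in> ball z s" using w \<open>s > 0\<close> by auto
    have "\<forall>\<^sub>F n in sequentially. cmod (deriv (h n) w) / (1 + (cmod (h n w))\<^sup>2) = spherical_deriv (f n) w"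
      using ev_h by eventually_elim (use \<open>w \<in> ball z s\<close> in simp)
    from Lim_transform_eventually[OF g(3)[OF w] this]
    show "(\<lambda>n. spherical_deriv (f n) w) \<longlonglongrightarrow> cmod (deriv g w) / (1 + (cmod (g w))\<^sup>2)" .
  qed
qed

section \<open>Affine changes of variable\<close>

lemma nicely_meromorphic_on_cong:
  assumes "f nicely_meromorphic_on V" "open V" and eq: "\<And>w. w \<in> V \<Longrightarrow> f w = g w"
  shows "g nicely_meromorphic_on V"
  unfolding nicely_meromorphic_on_def
proof (intro conjI ballI)
  have ev: "\<forall>\<^sub>F w in at z. f w = g w" if "z \<in> V" for z
    using eventually_at_in_open'[OF \<open>open V\<close> that] by eventually_elim (rule eq)
  have f: "f meromorphic_on V" using assms(1) by (simp add: nicely_meromorphic_on_def)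
  show "g meromorphic_on V"
    using f meromorphic_on_cong[of V f g V] ev by blast
  fix z assume z: "z \<in> V"
  have "(is_pole f z \<and> f z = 0) \<or> f \<midarrow>z\<rightarrow> f z" using assms(1) z by (auto simp: nicely_meromorphic_on_def)
  thus "(is_pole g z \<and> g z = 0) \<or> g \<midarrow>z\<rightarrow> g z"
    using is_pole_cong[OF ev[OF z] refl] tendsto_cong[OF ev[OF z], of "g z"] eq[OF z] by simp
qed

lemma nicely_meromorphic_on_affine:
  fixes c \<rho> :: complex
  assumes f: "f nicely_meromorphic_on D" and "\<rho> \<noteq> 0" and V: "\<And>w. w \<in> V \<Longrightarrow> c + \<rho> * w \<in> D"
  shows "(\<lambda>w. f (c + \<rho> * w)) nicely_meromorphic_on V"
  unfolding nicely_meromorphic_on_def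
proof (intro conjI ballI)
  show "(\<lambda>w. f (c + \<rho> * w)) meromorphic_on V"
  proof (rule meromorphic_on_compose[of f D])
    show "f meromorphic_on D" using f by (simp add: nicely_meromorphic_on_def)
    show "(\<lambda>w. c + \<rho> * w) analytic_on V" by (intro analytic_intros)
  qed (use V in blast)
  fix z assume z: "z \<in> V"
  have A: "filterlim (\<lambda>w. c + \<rho> * w) (at (c + \<rho> * z)) (at z)"
    unfolding filterlim_at
    using \<open>\<rho> \<noteq> 0\<close> by (auto intro!: tendsto_intros simp: eventually_at_filter)
  have "(is_pole f (c + \<rho> * z) \<and> f (c + \<rho> * z) = 0) \<or> f \<midarrow>c + \<rho> * z\<rightarrow> f (c + \<rho> * z)"
    using f V[OF z] by (auto simp: nicely_meromorphic_on_def)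
  thus "(is_pole (\<lambda>w. f (c + \<rho> * w)) z \<and> f (c + \<rho> * z) = 0) \<or> (\<lambda>w. f (c + \<rho> * w)) \<midarrow>z\<rightarrow> f (c + \<rho> * z)"
    unfolding is_pole_def using filterlim_compose[OF _ A, of f] by blast
qed

text \<open>The chain rule gives the formula at points that \<open>A\<close> maps to points of
  analyticity. These fill a punctured neighbourhood of \<open>z\<close>, and continuity of both
  sides extends the formula to poles.\<close>

lemma spherical_deriv_affine:
  fixes c \<rho> :: complex
  assumes f: "f nicely_meromorphic_on D" and "open D" "\<rho> \<noteq> 0" and z: "c + \<rho> * z \<in> D"
  shows "spherical_deriv (\<lambda>w. f (c + \<rho> * w)) z = cmod \<rho> * spherical_deriv f (c + \<rho> * z)"
proof -
  define A where "A = (\<lambda>w. c + \<rho> * w)"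
  define V where "V = A -` D"
  have A: "continuous_on UNIV A" unfolding A_def by (intro continuous_intros)
  have V: "open V" "z \<in> V" unfolding V_def
    using continuous_open_preimage[OF A open_UNIV \<open>open D\<close>] z by (auto simp: A_def)
  have g: "(\<lambda>w. f (A w)) nicely_meromorphic_on V"
    unfolding A_def by (rule nicely_meromorphic_on_affine[OF f \<open>\<rho> \<noteq> 0\<close>]) (simp add: V_def A_def)
  have nonpole: "spherical_deriv (\<lambda>w. f (A w)) w = cmod \<rho> * spherical_deriv f (A w)"
    if "f analytic_on {A w}" for w
  proof -
    have "f field_differentiable at (A w)" using that analytic_on_imp_differentiable_at by blast
    hence "(f has_field_derivative deriv f (A w)) (at (A w))"
      by (simp add: DERIV_deriv_iff_field_differentiable)
    moreover have "(A has_field_derivative \<rho>) (at w)"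
      unfolding A_def by (auto intro!: derivative_eq_intros)
    ultimately have "((\<lambda>w. f (A w)) has_field_derivative deriv f (A w) * \<rho>) (at w)"
      by (rule DERIV_chain2)
    hence "deriv (\<lambda>w. f (A w)) w = deriv f (A w) * \<rho>" by (rule DERIV_imp_deriv)
    moreover have "A analytic_on {w}" unfolding A_def by (intro analytic_intros)
    hence "(\<lambda>w. f (A w)) analytic_on {w}"
      using that analytic_on_compose_gen[of A "{w}" f "{A w}"] by (simp add: o_def)
    ultimately show ?thesis
      using that by (simp add: sphere_val_analytic(3) norm_mult mult.commute)
  qed
  have filt: "filterlim A (at (A z)) (at z)"
    unfolding filterlim_at A_def
    using \<open>\<rho> \<noteq> 0\<close> by (auto intro!: tendsto_intros simp: eventually_at_filter)
  have "isolated_singularity_at f (A z)"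
    using f z by (simp add: nicely_meromorphic_on_def meromorphic_on_isolated_singularity
        meromorphic_on_subset[of f D] A_def)
  hence "\<forall>\<^sub>F u in at (A z). f analytic_on {u}" by (simp add: isolated_singularity_at_altdef)
  hence "\<forall>\<^sub>F w in at z. f analytic_on {A w}"
    using filt by (rule eventually_compose_filterlim)
  hence ev: "\<forall>\<^sub>F w in at z. spherical_deriv (\<lambda>w. f (A w)) w = cmod \<rho> * spherical_deriv f (A w)"
    by eventually_elim (rule nonpole)
  have "isCont (spherical_deriv (\<lambda>w. f (A w))) z"
    using continuous_on_spherical_deriv[OF g V(1)] V by (simp add: continuous_on_eq_continuous_at)
  hence "spherical_deriv (\<lambda>w. f (A w)) \<midarrow>z\<rightarrow> spherical_deriv (\<lambda>w. f (A w)) z" by (simp add: isCont_def)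
  hence "(\<lambda>w. cmod \<rho> * spherical_deriv f (A w)) \<midarrow>z\<rightarrow> spherical_deriv (\<lambda>w. f (A w)) z"
    by (rule Lim_transform_eventually[OF _ ev])
  moreover have "isCont (spherical_deriv f) (A z)"
    using continuous_on_spherical_deriv[OF f \<open>open D\<close>] \<open>open D\<close> z by (simp add: continuous_on_eq_continuous_at A_def)
  hence "spherical_deriv f \<midarrow>A z\<rightarrow> spherical_deriv f (A z)" by (simp add: isCont_def)
  hence "(\<lambda>w. cmod \<rho> * spherical_deriv f (A w)) \<midarrow>z\<rightarrow> cmod \<rho> * spherical_deriv f (A z)"
    by (intro tendsto_intros filterlim_compose[OF _ filt])
  ultimately show ?thesis
    unfolding A_def by (rule tendsto_unique[OF trivial_limit_at])
qed

text \<open>Here \<open>G\<close> is a locally uniform limit and \<open>L\<close> the limit of the spherical derivatives. A point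
  with \<open>L p \<noteq> 0\<close> rules out the constant limit infinity.\<close>

lemma meromorphic_gluing:
  fixes L :: "complex \<Rightarrow> real"
  assumes chart: "\<And>z. \<exists>s>0. \<exists>h I. (I = id \<or> I = sphere_inv) \<and> h holomorphic_on ball z s \<and>
      (\<forall>w\<in>ball z s. G w = I (Some (h w)) \<and> L w = cmod (deriv h w) / (1 + (cmod (h w))\<^sup>2))"
    and "L p \<noteq> 0"
  obtains g where "g nicely_meromorphic_on UNIV" "sphere_val g = G" "spherical_deriv g = L"
proof -
  have h_zero: "h w = 0" if "sphere_inv (Some (h w)) = None" for h :: "complex \<Rightarrow> complex" and w
    using that by (auto simp: sphere_inv_def split: if_splits)
  \<comment> \<open>The identity theorem on a disc.\<close>
  have ident: "\<forall>u\<in>ball z s. h u = 0"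
    if h: "h holomorphic_on ball z s" and w: "w \<in> ball z s" and ev: "\<forall>\<^sub>F u in nhds w. h u = 0" for h z s w
  proof (rule ccontr)
    assume "\<not> ?thesis"
    then obtain b where "b \<in> ball z s" "h b \<noteq> 0" by blast
    from non_zero_neighbour_alt[OF h open_ball connected_ball w this]
    have "\<forall>\<^sub>F u in at w. h u \<noteq> 0" by (auto elim: eventually_mono)
    moreover have "\<forall>\<^sub>F u in at w. h u = 0" using ev by (auto simp: eventually_at_filter elim: eventually_mono)
    ultimately have "\<forall>\<^sub>F u in at w. False" by eventually_elim simp
    thus False by simp
  qed
  \<comment> \<open>The set near whose points \<open>G\<close> is identically infinity. It turns out
    to be open and closed, hence empty or the whole plane.\<close>
  define E where "E = {z. \<forall>\<^sub>F w in nhds z. G w = None}"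
  have ev_E: "\<forall>\<^sub>F u in nhds w. h u = 0"
    if "w \<in> E" "w \<in> ball z s" "\<forall>w\<in>ball z s. G w = sphere_inv (Some (h w))" for w z s h
  proof -
    have "\<forall>\<^sub>F u in nhds w. u \<in> ball z s" using that(2) by (intro eventually_nhds_in_open) auto
    moreover have "\<forall>\<^sub>F u in nhds w. G u = None" using that(1) by (simp add: E_def)
    ultimately show ?thesis by eventually_elim (use that(3) h_zero[of h] in auto)
  qed
  have E_None: "G w = None" if "w \<in> E" for w
    using that eventually_nhds_x_imp_x unfolding E_def by blast
  have "open E"
    unfolding open_subopen[of E]
  proof
    fix z assume "z \<in> E"
    then obtain S where "open S" "z \<in> S" "\<forall>w\<in>S. G w = None" unfolding E_def eventually_nhds by blast
    moreover from this have "S \<subseteq> E" unfolding E_def eventually_nhds by blast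
    ultimately show "\<exists>T. open T \<and> z \<in> T \<and> T \<subseteq> E" by blast
  qed
  moreover have "open (- E)"
    unfolding open_subopen[of "- E"]
  proof
    fix z assume z: "z \<in> - E"
    obtain s h I where s: "s > 0" and I: "I = id \<or> I = sphere_inv" and h: "h holomorphic_on ball z s"
      and G: "\<forall>w\<in>ball z s. G w = I (Some (h w))"
      using chart[of z] by blast
    \<comment> \<open>If the chart around \<open>z\<close> met \<open>E\<close>, then
      \<open>h\<close> would vanish identically on the disc, and \<open>z\<close> itself would lie
      in \<open>E\<close>.\<close>
    have "w \<notin> E" if w: "w \<in> ball z s" for w
    proof
      assume "w \<in> E"
      have "I \<noteq> id" using E_None[OF \<open>w \<in> E\<close>] G w by auto
      with I have Ii: "I = sphere_inv" by blast
      have "\<forall>u\<in>ball z s. h u = 0"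
        using ident[OF h w] ev_E[OF \<open>w \<in> E\<close> w, of h] G Ii by blast
      hence "\<forall>u\<in>ball z s. G u = None" using G Ii by (simp add: sphere_inv_def)
      hence "z \<in> E" unfolding E_def eventually_nhds using s by (intro CollectI exI[of _ "ball z s"]) auto
      with z show False by blast
    qed
    thus "\<exists>T. open T \<and> z \<in> T \<and> T \<subseteq> - E" using s by (intro exI[of _ "ball z s"]) auto
  qed
  ultimately have "E = {} \<or> E = UNIV"
    using clopen[of E] by (simp add: closed_def)
  moreover have "p \<notin> E"
  proof
    assume "p \<in> E"
    obtain s h I where s: "s > 0" and I: "I = id \<or> I = sphere_inv" and h: "h holomorphic_on ball p s"
      and G: "\<forall>w\<in>ball p s. G w = I (Some (h w))"
      and L: "L p = cmod (deriv h p) / (1 + (cmod (h p))\<^sup>2)"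
      using chart[of p] centre_in_ball by blast
    have "I \<noteq> id" using E_None[OF \<open>p \<in> E\<close>] G s by auto
    \<comment> \<open>A chart function vanishing near \<open>p\<close> has derivative 0 there, so
      \<open>L p\<close> would be 0.\<close>
    hence "\<forall>\<^sub>F u in nhds p. h u = 0" using I G ev_E[OF \<open>p \<in> E\<close>, of p s h] s by auto
    hence "deriv h p = deriv (\<lambda>_. 0) p" by (intro deriv_cong_ev) auto
    with L \<open>L p \<noteq> 0\<close> show False by simp
  qed
  ultimately have E: "E = {}" by blast

  \<comment> \<open>The value 0 where \<open>G\<close> is infinite is the dummy value required at
    poles; it also equals \<open>inverse 0\<close>, so \<open>g\<close> is the reciprocal of
    \<open>h\<close> on the whole of an inverted chart.\<close>
  define g where "g = (\<lambda>z. case G z of None \<Rightarrow> 0 | Some a \<Rightarrow> a)"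
  have loc: "g nicely_meromorphic_on {z} \<and> sphere_val g z = G z" for z
  proof -
    obtain s h I where s: "s > 0" and I: "I = id \<or> I = sphere_inv" and h: "h holomorphic_on ball z s"
      and G: "\<forall>w\<in>ball z s. G w = I (Some (h w))"
      using chart[of z] by blast
    have z: "z \<in> ball z s" using s by simp
    have ha: "h analytic_on ball z s" using h by (simp add: analytic_on_open)
    show ?thesis using I
    proof
      assume "I = id"
      hence gh: "g w = h w" if "w \<in> ball z s" for w using G that by (simp add: g_def)
      have "g holomorphic_on ball z s"
        by (rule holomorphic_transform[OF h]) (simp only: gh)
      hence "g analytic_on {z}" using s analytic_at[of g z] by (metis open_ball z)
      thus ?thesis
        using analytic_on_imp_nicely_meromorphic_on sphere_val_analytic(2) gh G z \<open>I = id\<close> by auto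
    next
      assume Ii: "I = sphere_inv"
      hence gh: "inverse (h w) = g w" if "w \<in> ball z s" for w using G that by (simp add: g_def sphere_inv_def)
      have "h nicely_meromorphic_on ball z s" by (rule analytic_on_imp_nicely_meromorphic_on[OF ha])
      from nicely_meromorphic_on_cong[OF nicely_meromorphic_on_inverse[OF this] open_ball gh]
      have g: "g nicely_meromorphic_on ball z s" by blast
      hence gz: "g nicely_meromorphic_on {z}" by (rule nicely_meromorphic_on_subset) (use z in auto)
      have ev: "\<forall>\<^sub>F w in at z. w \<in> ball z s" using z by (intro eventually_at_in_open') auto
      have hz: "isCont h z" using h z continuous_on_eq_continuous_at holomorphic_on_imp_continuous_on open_ball by blast
      have "\<forall>\<^sub>F w in at z. inverse (h w) = g w" using ev by eventually_elim (rule gh)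
      from is_pole_cong[OF this refl] have pole: "is_pole g z \<longleftrightarrow> isolated_zero h z"
        by (simp add: is_pole_inverse_iff)
      have "sphere_val g z = G z"
      proof (cases "h z = 0")
        case True
        \<comment> \<open>Emptiness of \<open>E\<close> makes the zero of \<open>h\<close> isolated,
          so that \<open>g\<close> has a genuine pole.\<close>
        have "\<exists>b\<in>ball z s. h b \<noteq> 0"
        proof (rule ccontr)
          assume "\<not> ?thesis"
          hence "\<forall>w\<in>ball z s. G w = None" using G Ii by (simp add: sphere_inv_def)
          hence "z \<in> E" unfolding E_def eventually_nhds using z by (intro CollectI exI[of _ "ball z s"]) auto
          with E show False by blast
        qed
        then obtain b where "b \<in> ball z s" "h b \<noteq> 0" by blast
        from non_zero_neighbour_alt[OF h open_ball connected_ball z this]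
        have "\<forall>\<^sub>F u in at z. h u \<noteq> 0" by (auto elim: eventually_mono)
        moreover have "h \<midarrow>z\<rightarrow> 0" using hz True by (simp add: isCont_def)
        ultimately have "isolated_zero h z" by (simp add: isolated_zero_def)
        with pole show ?thesis using True G z Ii by (simp add: sphere_val_def sphere_inv_def)
      next
        case False
        hence "\<not> isolated_zero h z" using zero_isolated_zero[OF _ hz] by blast
        with pole show ?thesis using False G z Ii gh[OF z] by (simp add: sphere_val_def sphere_inv_def)
      qed
      with gz show ?thesis by blast
    qed
  qed
  hence gU: "g nicely_meromorphic_on UNIV" "sphere_val g = G"
    unfolding nicely_meromorphic_on_def meromorphic_on_def by auto
  moreover have "spherical_deriv g z = L z" for z
  proof -
    obtain s h I where s: "s > 0" and I: "I = id \<or> I = sphere_inv" and h: "h holomorphic_on ball z s"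
      and G: "\<forall>w\<in>ball z s. G w = I (Some (h w))"
      and L: "L z = cmod (deriv h z) / (1 + (cmod (h z))\<^sup>2)"
      using chart[of z] centre_in_ball by blast
    have z: "z \<in> ball z s" using s by simp
    have ev: "\<forall>\<^sub>F w in nhds z. w \<in> ball z s" using z by (intro eventually_nhds_in_open) auto
    show ?thesis using I
    proof
      assume "I = id"
      hence gh: "g w = h w" if "w \<in> ball z s" for w using G that by (simp add: g_def)
      have "g holomorphic_on ball z s"
        by (rule holomorphic_transform[OF h]) (simp only: gh)
      hence "g analytic_on {z}" using s analytic_at[of g z] by (metis open_ball z)
      moreover have "deriv g z = deriv h z"
        by (rule deriv_cong_ev) (use ev gh in \<open>auto elim: eventually_mono\<close>)
      ultimately show ?thesis using L gh[OF z] by (simp add: sphere_val_analytic(3))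
    next
      assume Ii: "I = sphere_inv"
      hence gh: "inverse (g w) = h w" if "w \<in> ball z s" for w using G that by (simp add: g_def sphere_inv_def)
      \<comment> \<open>In an inverted chart \<open>h\<close> is finite, so its reciprocal is never
        0.\<close>
      have "sphere_val g w \<noteq> Some 0" if "w \<in> ball z s" for w
        using G that Ii gU(2) by (auto simp: sphere_inv_def)
      from nicely_meromorphic_reciprocal(3)[OF nicely_meromorphic_on_subset[OF gU(1)] open_ball this z]
      have "spherical_deriv g z = cmod (deriv (\<lambda>w. inverse (g w)) z) / (1 + (cmod (inverse (g z)))\<^sup>2)" by simp
      moreover have "deriv (\<lambda>w. inverse (g w)) z = deriv h z"
        by (rule deriv_cong_ev) (use ev gh in \<open>auto elim: eventually_mono\<close>)
      ultimately show ?thesis using L gh[OF z] by simp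
    qed
  qed
  ultimately show ?thesis by (intro that) auto
qed

section \<open>The limit of the rescaled functions\<close>

text \<open>On a fixed disc the spherical derivatives are eventually at most 2, which gives a
  convergent subsequence. They converge as well: their bound tends to 1 since
  \<open>cmod w / R k\<close> tends to 0, and the limiting value 1 at the origin is the nonzero
  value that the gluing of charts requires.\<close>

lemma spherical_limit_meromorphic:
  fixes g :: "nat \<Rightarrow> complex \<Rightarrow> complex" and R :: "nat \<Rightarrow> real"
  assumes R: "\<And>k. R k > real k + 1"
    and mero: "\<And>k. g k nicely_meromorphic_on ball 0 (R k)"
    and bound: "\<And>k w. cmod w < R k \<Longrightarrow> spherical_deriv (g k) w \<le> 1 + cmod w / R k"
    and at_0: "\<And>k. spherical_deriv (g k) 0 = 1"
  obtains j G where "strict_mono (j :: nat \<Rightarrow> nat)" "G nicely_meromorphic_on UNIV"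
    "spherical_loc_uniform_limit UNIV (\<lambda>k. sphere_val (g (j k))) (sphere_val G)"
    "\<And>w. spherical_deriv G w \<le> 1" "spherical_deriv G 0 = 1"
proof -
  \<comment> \<open>The constant is 4 times the bound 2, and \<open>R n > real n + 1\<close> puts
    the closed disc of radius \<open>i\<close> inside the domain for all
    \<open>n \<ge> i\<close>.\<close>
  have lip: "dist (riemann_point (sphere_val (g n) x)) (riemann_point (sphere_val (g n) y)) \<le> 8 * dist x y"
    if "n \<ge> i" "x \<in> cball 0 (real i)" "y \<in> cball 0 (real i)" for n i x y
  proof -
    have Rn: "R n > 0" "ball 0 (R n) \<supseteq> cball 0 (real i)" using R[of n] that(1) by auto
    have "spherical_deriv (g n) z \<le> 2" if "z \<in> ball 0 (R n)" for z
    proof -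
      have "cmod z / R n \<le> 1" using that Rn by simp
      with bound[of z n] that show ?thesis by simp
    qed
    from spherical_deriv_lipschitz[OF mero open_ball convex_ball this] that Rn show ?thesis by fastforce
  qed
  obtain j L where j: "strict_mono (j :: nat \<Rightarrow> nat)" and
    lim: "\<And>i. uniform_limit (cball 0 (real i)) (\<lambda>n x. riemann_point (sphere_val (g (j n)) x)) (\<lambda>x. riemann_point (L x)) sequentially"
    using eventually_equi_lipschitz_convergent_subsequence[of "\<lambda>i. cball 0 (real i)" "\<lambda>i. i" "\<lambda>n. sphere_val (g n)" "\<lambda>_. 8"]
      lip compact_cball by blast
  have j_ge: "n \<le> j n" for n using seq_suble[OF j] .
  have ex_i: "\<exists>i. ball z 1 \<subseteq> cball 0 (real i)" for z :: complex
  proof -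
    obtain i where i: "cmod z + 1 \<le> real i" using real_arch_simple by blast
    have "cmod w \<le> real i" if "dist z w < 1" for w
      using that i norm_triangle_ineq4[of z "z - w"] by (simp add: dist_norm)
    thus ?thesis by (intro exI[of _ i]) auto
  qed
  define \<sigma> where "\<sigma> = (\<lambda>w. lim (\<lambda>n. spherical_deriv (g (j n)) w))"
  have chart: "\<exists>s>0. \<exists>h I. (I = id \<or> I = sphere_inv) \<and> h holomorphic_on ball z s \<and>
      (\<forall>w\<in>ball z s. L w = I (Some (h w)) \<and> \<sigma> w = cmod (deriv h w) / (1 + (cmod (h w))\<^sup>2) \<and>
         (\<lambda>n. spherical_deriv (g (j n)) w) \<longlonglongrightarrow> \<sigma> w)" for z
  proof -
    obtain i where i: "ball z 1 \<subseteq> cball 0 (real i)" using ex_i by blast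
    note lim_z = uniform_limit_on_subset[OF lim i]
    have ev: "\<forall>\<^sub>F n in sequentially. g (j n) nicely_meromorphic_on ball z 1"
      using eventually_ge_at_top[of i]
    proof eventually_elim
      case (elim n)
      have "R (j n) > real i" using R[of "j n"] j_ge[of n] elim by linarith
      hence "ball z 1 \<subseteq> ball 0 (R (j n))" using i by auto
      thus ?case using mero nicely_meromorphic_on_subset by blast
    qed
    have "continuous_on (ball z 1) (\<lambda>x. riemann_point (L x))"
    proof (rule uniform_limit_theorem[OF _ lim_z trivial_limit_sequentially])
      show "\<forall>\<^sub>F n in sequentially. continuous_on (ball z 1) (\<lambda>x. riemann_point (sphere_val (g (j n)) x))"
        using eventually_ge_at_top[of i]
      proof eventually_elim
        case (elim n)
        have "8-lipschitz_on (ball z 1) (\<lambda>x. riemann_point (sphere_val (g (j n)) x))"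
          using i lip[of i "j n"] elim j_ge[of n] by (intro lipschitz_onI) (auto simp: subset_iff)
        thus ?case by (rule lipschitz_on_continuous_on)
      qed
    qed
    hence "isCont (\<lambda>x. riemann_point (L x)) z" by (simp add: continuous_on_eq_continuous_at)
    note chart = meromorphic_spherical_limit_chart[OF zero_less_one ev lim_z this]
    obtain s h I where s: "s > 0" "I = id \<or> I = sphere_inv" "h holomorphic_on ball z s"
      "\<And>w. w \<in> ball z s \<Longrightarrow> L w = I (Some (h w))"
      "\<And>w. w \<in> ball z s \<Longrightarrow> (\<lambda>n. spherical_deriv (g (j n)) w) \<longlonglongrightarrow> cmod (deriv h w) / (1 + (cmod (h w))\<^sup>2)"
      by (rule chart) (rule that)
    moreover have "\<sigma> w = cmod (deriv h w) / (1 + (cmod (h w))\<^sup>2)" if "w \<in> ball z s" for w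
      unfolding \<sigma>_def using s(5)[OF that] by (rule limI)
    ultimately show ?thesis by (intro exI[of _ s] exI[of _ h] exI[of _ I] conjI) auto
  qed
  have \<sigma>: "(\<lambda>n. spherical_deriv (g (j n)) w) \<longlonglongrightarrow> \<sigma> w" for w
    using chart[of w] centre_in_ball by blast
  have "(\<lambda>n. spherical_deriv (g (j n)) 0) \<longlonglongrightarrow> 1" by (simp add: at_0)
  with \<sigma>[of 0] have \<sigma>0: "\<sigma> 0 = 1" by (rule LIMSEQ_unique)
  have R_top: "filterlim (\<lambda>n. R (j n)) at_top sequentially"
  proof (rule filterlim_at_top_mono[OF filterlim_real_sequentially], rule always_eventually, rule allI)
    show "real n \<le> R (j n)" for n using R[of "j n"] j_ge[of n] by linarith
  qed
  have \<sigma>1: "\<sigma> w \<le> 1" for w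
  proof (rule tendsto_le[OF trivial_limit_sequentially _ \<sigma>])
    show "(\<lambda>n. 1 + cmod w / R (j n)) \<longlonglongrightarrow> 1"
      by (rule tendsto_eq_intros tendsto_divide_0[OF tendsto_const filterlim_at_top_imp_at_infinity[OF R_top]] refl | simp)+
    show "\<forall>\<^sub>F n in sequentially. spherical_deriv (g (j n)) w \<le> 1 + cmod w / R (j n)"
      using filterlim_at_top_dense[THEN iffD1, OF R_top, rule_format, of "cmod w"]
      by eventually_elim (rule bound)
  qed
  have "\<exists>s>0. \<exists>h I. (I = id \<or> I = sphere_inv) \<and> h holomorphic_on ball z s \<and>
      (\<forall>w\<in>ball z s. L w = I (Some (h w)) \<and> \<sigma> w = cmod (deriv h w) / (1 + (cmod (h w))\<^sup>2))" for z
    using chart[of z] by blast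
  from meromorphic_gluing[OF this, of 0] \<sigma>0 obtain G
    where G: "G nicely_meromorphic_on UNIV" "sphere_val G = L" "spherical_deriv G = \<sigma>"
    by auto
  have "spherical_loc_uniform_limit UNIV (\<lambda>k. sphere_val (g (j k))) (sphere_val G)"
  proof (rule spherical_loc_uniform_limitI)
    fix z :: complex
    obtain i where i: "ball z 1 \<subseteq> cball 0 (real i)" using ex_i by blast
    show "\<exists>V. open V \<and> z \<in> V \<and> V \<subseteq> UNIV \<and>
       uniform_limit V (\<lambda>n x. riemann_point (sphere_val (g (j n)) x)) (\<lambda>x. riemann_point (sphere_val G x)) sequentially"
      using uniform_limit_on_subset[OF lim i] G(2) by (intro exI[of _ "ball z 1"]) auto
  qed
  with j G \<sigma>0 \<sigma>1 show ?thesis by (intro that) auto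
qed

section \<open>Existence of the rescaling data and conclusion\<close>

text \<open>One step of the sequence: failure of Marty's bound on a small disc provides a starting
  point, which \<open>point_picking\<close> with the tail potential improves. The single
  \<open>e\<close> controls all quantities that have to tend to 0.\<close>

lemma exists_rescaling_point:
  assumes "t\<^sub>0 > 0" and pos: "\<And>t. t \<ge> t\<^sub>0 \<Longrightarrow> \<phi> t > 0" and "mono_on {t\<^sub>0..} \<phi>"
    and lim: "((\<lambda>t. \<phi> t / t) \<longlongrightarrow> 0) at_top"
    and "(\<lambda>t. 1 / (t * \<phi> t)) integrable_on {t\<^sub>0..}"
    and "open D" "z\<^sub>0 \<in> D" and mero: "\<And>f. f \<in> \<F> \<Longrightarrow> f nicely_meromorphic_on D"
    and not_normal: "\<not> normal_at D \<F> z\<^sub>0" and "e > 0"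
  obtains f z \<rho> where "f \<in> \<F>" "z \<in> D" "dist z z\<^sub>0 < e" "0 < \<rho>" "\<rho> < e" "t\<^sub>0 \<le> 1 / \<rho>"
    "\<rho> * \<phi> (1 / \<rho>) < e" "spherical_deriv f z = 1 / \<rho>"
    "\<And>w. dist w z < 1 / \<phi> (1 / \<rho>) \<Longrightarrow> w \<in> D \<and> spherical_deriv f w \<le> 1 / \<rho> * (1 + \<phi> (1 / \<rho>) * dist w z)"
proof -
  obtain H where H: "continuous_on {2 * t\<^sub>0..} H" "antimono_on {2 * t\<^sub>0..} H" "(H \<longlongrightarrow> 0) at_top"
    "\<And>L x. L \<ge> 2 * t\<^sub>0 \<Longrightarrow> 0 < x \<Longrightarrow> x \<le> 1 \<Longrightarrow> H (L * (1 + x)) + x / \<phi> L < H L"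
    "\<And>L. L \<ge> 2 * t\<^sub>0 \<Longrightarrow> 1 / \<phi> L \<le> H L"
    using tail_potential[OF assms(1,2,3,5)] by blast
  obtain r where r: "r > 0" "ball z\<^sub>0 r \<subseteq> D"
    using \<open>open D\<close> \<open>z\<^sub>0 \<in> D\<close> openE by blast
  \<comment> \<open>The starting point lies within \<open>s\<close> of \<open>z\<^sub>0\<close> and
    the search within \<open>s\<close> of the starting point, so 2\<open>s\<close> must stay below
    both \<open>r\<close> and \<open>e\<close>.\<close>
  define s where "s = min (r / 2) (e / 2)"
  have s: "s > 0" "2 * s \<le> r" "2 * s \<le> e" using r \<open>e > 0\<close> by (auto simp: s_def)
  have "\<forall>\<^sub>F t in at_top. 2 * H t < s"
    using order_tendstoD(2)[OF tendsto_mult_left[OF H(3), of 2], of s] s by simp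
  moreover have "\<forall>\<^sub>F t in at_top. \<phi> t / t < e" by (rule order_tendstoD(2)[OF lim \<open>e > 0\<close>])
  moreover have "\<forall>\<^sub>F t in at_top. t > max (2 * t\<^sub>0) (1 / e)" by (rule eventually_gt_at_top)
  ultimately have "\<forall>\<^sub>F t in at_top. 2 * H t < s \<and> \<phi> t / t < e \<and> t > max (2 * t\<^sub>0) (1 / e)"
    by eventually_elim simp
  \<comment> \<open>The three conditions give, in turn, a short search distance,
    \<open>\<rho> * \<phi> (1 / \<rho>) < e\<close>, and both \<open>\<rho> < e\<close> and the
    admissibility of \<open>1 / \<rho>\<close>.\<close>
  then obtain N where N: "\<And>t. t \<ge> N \<Longrightarrow> 2 * H t < s \<and> \<phi> t / t < e \<and> t > max (2 * t\<^sub>0) (1 / e)"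
    unfolding eventually_at_top_linorder by blast
  have "s \<le> r" using s by linarith
  hence "ball z\<^sub>0 s \<subseteq> D" using r(2) subset_ball by blast
  hence "\<exists>f\<in>\<F>. \<exists>a\<in>ball z\<^sub>0 s. \<not> spherical_deriv f a \<le> N"
    using normal_at_if_spherical_deriv_bounded[OF s(1) _ mero] not_normal by blast
  then obtain f a where f: "f \<in> \<F>" and a: "dist z\<^sub>0 a < s" "spherical_deriv f a \<ge> N"
    by auto
  let ?M = "spherical_deriv f"
  have sub: "cball a s \<subseteq> D"
  proof
    fix w assume "w \<in> cball a s"
    hence "dist z\<^sub>0 w < r" using a s dist_triangle[of z\<^sub>0 w a] by simp
    thus "w \<in> D" using r by auto
  qed
  have "continuous_on (cball a s) ?M"
    using continuous_on_spherical_deriv[OF mero[OF f] \<open>open D\<close>] sub continuous_on_subset by blast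
  moreover have "\<phi> L > 0" if "L \<ge> 2 * t\<^sub>0" for L using that pos[of L] \<open>t\<^sub>0 > 0\<close> by simp
  moreover have "2 * t\<^sub>0 \<ge> 0" "?M a \<ge> 2 * t\<^sub>0" "2 * H (?M a) \<le> s" using \<open>t\<^sub>0 > 0\<close> N[OF a(2)] by auto
  ultimately obtain z where z: "dist z a \<le> H (?M a)" "?M z \<ge> ?M a" "ball z (1 / \<phi> (?M z)) \<subseteq> cball a s"
    "\<And>w. dist w z < 1 / \<phi> (?M z) \<Longrightarrow> ?M w \<le> ?M z * (1 + \<phi> (?M z) * dist w z)"
    using point_picking[of a s ?M "2 * t\<^sub>0" H \<phi>] H(1,2,4,5) by blast
  define \<rho> where "\<rho> = 1 / ?M z"
  have \<rho>: "1 / \<rho> = ?M z" by (simp add: \<rho>_def)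
  have M: "?M z > 0" "\<phi> (?M z) / ?M z < e" "?M z > max (2 * t\<^sub>0) (1 / e)"
    using N[of "?M z"] a z(2) \<open>t\<^sub>0 > 0\<close> by auto
  have "dist z a < s" using z(1) N[OF a(2)] s(1) by linarith
  show ?thesis
  proof
    show "f \<in> \<F>" by (fact f)
    show "z \<in> D" using \<open>dist z a < s\<close> sub by (auto simp: dist_commute)
    show "dist z z\<^sub>0 < e"
      using \<open>dist z a < s\<close> a(1) s(3) dist_triangle[of z z\<^sub>0 a] by (simp add: dist_commute)
    show "0 < \<rho>" using M by (simp add: \<rho>_def)
    have "1 / e < ?M z" using M by simp
    thus "\<rho> < e" using M(1) \<open>e > 0\<close> by (simp add: \<rho>_def field_simps)
    show "t\<^sub>0 \<le> 1 / \<rho>" "spherical_deriv f z = 1 / \<rho>" unfolding \<rho> using M \<open>t\<^sub>0 > 0\<close> by auto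
    show "\<rho> * \<phi> (1 / \<rho>) < e" unfolding \<rho> using M(2) by (simp add: \<rho>_def)
    show "w \<in> D \<and> spherical_deriv f w \<le> 1 / \<rho> * (1 + \<phi> (1 / \<rho>) * dist w z)"
      if "dist w z < 1 / \<phi> (1 / \<rho>)" for w
      using that z(3,4) sub unfolding \<rho> by (auto simp: dist_commute subset_iff)
  qed
qed

theorem lemma2p2:
  fixes t\<^sub>0 :: real and \<phi> :: "real \<Rightarrow> real"
    and D :: "complex set" and z\<^sub>0 :: complex and \<F> :: "(complex \<Rightarrow> complex) set"
  assumes "t\<^sub>0 > 0"
    and "\<And>t. t \<ge> t\<^sub>0 \<Longrightarrow> \<phi> t > 0"
    and "mono_on {t\<^sub>0..} \<phi>"
    and "((\<lambda>t. \<phi> t / t) \<longlongrightarrow> 0) at_top"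
    and "(\<lambda>t. 1 / (t * \<phi> t)) integrable_on {t\<^sub>0..}"
    and "open D" and "connected D" and "z\<^sub>0 \<in> D"
    and "\<And>f. f \<in> \<F> \<Longrightarrow> f nicely_meromorphic_on D"
    and "\<not> normal_at D \<F> z\<^sub>0"
  shows "\<exists>(f :: nat \<Rightarrow> complex \<Rightarrow> complex) (z :: nat \<Rightarrow> complex) (\<rho> :: nat \<Rightarrow> real)
            (g :: complex \<Rightarrow> complex) (R :: nat \<Rightarrow> real).
     (\<forall>k. f k \<in> \<F>) \<and> (\<forall>k. z k \<in> D) \<and> (\<forall>k. \<rho> k > 0 \<and> 1 / \<rho> k \<ge> t\<^sub>0) \<and>
     g nicely_meromorphic_on UNIV \<and> \<not> g constant_on UNIV \<and>
     z \<longlonglongrightarrow> z\<^sub>0 \<and> \<rho> \<longlonglongrightarrow> 0 \<and>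
     spherical_loc_uniform_limit UNIV
       (\<lambda>k. sphere_val (\<lambda>w. f k (z k + of_real (\<rho> k) * w))) (sphere_val g) \<and>
     (\<forall>w. spherical_deriv g w \<le> 1) \<and> spherical_deriv g 0 = 1 \<and>
     (\<forall>k. R k = 1 / (\<rho> k * \<phi> (1 / \<rho> k))) \<and>
     filterlim R at_top sequentially \<and>
     (\<forall>k. \<forall>w. cmod w < R k \<longrightarrow>
        z k + of_real (\<rho> k) * w \<in> D \<and>
        spherical_deriv (\<lambda>w. f k (z k + of_real (\<rho> k) * w)) w \<le> 1 + cmod w / R k)"
proof -
  define P where "P = (\<lambda>(k :: nat) f z \<rho>. f \<in> \<F> \<and> z \<in> D \<and> dist z z\<^sub>0 < 1 / real (k + 2) \<and>
    0 < \<rho> \<and> \<rho> < 1 / real (k + 2) \<and> t\<^sub>0 \<le> 1 / \<rho> \<and> \<rho> * \<phi> (1 / \<rho>) < 1 / real (k + 2) \<and>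
    spherical_deriv f z = 1 / \<rho> \<and> (\<forall>w. dist w z < 1 / \<phi> (1 / \<rho>) \<longrightarrow>
      w \<in> D \<and> spherical_deriv f w \<le> 1 / \<rho> * (1 + \<phi> (1 / \<rho>) * dist w z)))"
  have "\<exists>f z \<rho>. P k f z \<rho>" for k
  proof -
    have "1 / real (k + 2) > 0" by simp
    from exists_rescaling_point[OF assms(1-6,8-10) this] show ?thesis
      unfolding P_def by (smt (verit))
  qed
  then obtain f z \<rho> where P: "\<And>k. P k (f k) (z k) (\<rho> k)" by metis
  define R where "R = (\<lambda>k. 1 / (\<rho> k * \<phi> (1 / \<rho> k)))"
  define g where "g = (\<lambda>k w. f k (z k + of_real (\<rho> k) * w))"
  have \<phi>: "\<phi> (1 / \<rho> k) > 0" for k using P[of k] assms(2) by (auto simp: P_def)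
  have \<rho>: "\<rho> k > 0" for k using P[of k] by (auto simp: P_def)
  have R_pos: "R k > 0" for k using \<phi> \<rho> by (simp add: R_def)
  \<comment> \<open>The tolerance 1/(k + 2) for \<open>\<rho> k * \<phi> (1 / \<rho> k)\<close> is
    the reciprocal of a lower bound for \<open>R k\<close>.\<close>
  have R: "R k > real k + 1" for k
  proof -
    have "\<rho> k * \<phi> (1 / \<rho> k) < 1 / real (k + 2)" using P[of k] by (simp add: P_def)
    hence "R k > real (k + 2)"
      unfolding R_def using \<phi>[of k] \<rho>[of k] by (simp add: field_simps)
    thus ?thesis by simp
  qed
  have near: "dist (z k + of_real (\<rho> k) * w) (z k) = \<rho> k * cmod w" for k w
    using \<rho>[of k] by (simp add: dist_norm norm_mult)
  have close: "\<rho> k * cmod w < 1 / \<phi> (1 / \<rho> k)" if "cmod w < R k" for k w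
    using that \<rho>[of k] \<phi>[of k] by (simp add: R_def field_simps)
  have in_D: "z k + of_real (\<rho> k) * w \<in> D" if "cmod w < R k" for k w
    using P[of k] close[OF that] near[of k w] by (auto simp: P_def)
  have f: "f k nicely_meromorphic_on D" for k using P[of k] assms(9) by (auto simp: P_def)
  have gd: "spherical_deriv (g k) w = \<rho> k * spherical_deriv (f k) (z k + of_real (\<rho> k) * w)"
    if "cmod w < R k" for k w
    unfolding g_def using spherical_deriv_affine[OF f \<open>open D\<close> _ in_D[OF that]] \<rho>[of k] by simp
  have bound: "spherical_deriv (g k) w \<le> 1 + cmod w / R k" if "cmod w < R k" for k w
  proof -
    have "spherical_deriv (f k) (z k + of_real (\<rho> k) * w) \<le> 1 / \<rho> k * (1 + \<phi> (1 / \<rho> k) * (\<rho> k * cmod w))"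
      using P[of k] close[OF that] unfolding near[of k w, symmetric] by (auto simp: P_def)
    \<comment> \<open>Multiplication by \<open>\<rho> k\<close> cancels the factor
      \<open>1 / \<rho> k\<close>, and \<open>\<phi> (1 / \<rho> k) * \<rho> k\<close> is
      \<open>1 / R k\<close>.\<close>
    from mult_left_mono[OF this, of "\<rho> k"]
    show ?thesis unfolding gd[OF that] using \<rho>[of k] by (simp add: R_def mult_ac)
  qed
  have mero: "g k nicely_meromorphic_on ball 0 (R k)" for k
    unfolding g_def using in_D \<rho>[of k] by (intro nicely_meromorphic_on_affine[OF f]) auto
  have at_0: "spherical_deriv (g k) 0 = 1" for k
    using gd[of 0 k] R_pos[of k] P[of k] by (simp add: P_def)
  obtain j G where j: "strict_mono (j :: nat \<Rightarrow> nat)" and G: "G nicely_meromorphic_on UNIV"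
    "spherical_loc_uniform_limit UNIV (\<lambda>k. sphere_val (g (j k))) (sphere_val G)"
    "\<And>w. spherical_deriv G w \<le> 1" "spherical_deriv G 0 = 1"
    using spherical_limit_meromorphic[of R g] R mero bound at_0 by blast
  have lim0: "(\<lambda>k. 1 / real (k + 2)) \<longlonglongrightarrow> 0"
    using LIMSEQ_ignore_initial_segment[OF lim_inverse_n', of 2] by simp
  have "z \<longlonglongrightarrow> z\<^sub>0"
    by (rule metric_tendsto_imp_tendsto[OF lim0])
      (use P in \<open>auto simp: P_def intro!: always_eventually less_imp_le\<close>)
  moreover have "\<rho> \<longlonglongrightarrow> 0"
    by (rule tendsto_sandwich[OF _ _ tendsto_const lim0])
      (use P in \<open>auto simp: P_def intro!: always_eventually less_imp_le\<close>)
  moreover have "real k \<le> R k" for k using R[of k] by linarith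
  hence "filterlim R at_top sequentially"
    by (intro filterlim_at_top_mono[OF filterlim_real_sequentially] always_eventually) blast
  \<comment> \<open>A constant has spherical derivative 0 at the origin, not 1.\<close>
  moreover have "\<not> G constant_on UNIV"
  proof
    assume "G constant_on UNIV"
    then obtain c where "G = (\<lambda>_. c)" by (auto simp: constant_on_def)
    with G(4) show False by (simp add: spherical_deriv_def)
  qed
  \<comment> \<open>All sequences are restricted to the subsequence \<open>j\<close>; the bounds
    hold for every index, and the limits are inherited.\<close>
  ultimately show ?thesis
    using P j G bound in_D
    by (intro exI[of _ "f \<circ> j"] exI[of _ "z \<circ> j"] exI[of _ "\<rho> \<circ> j"] exI[of _ G] exI[of _ "R \<circ> j"])
      (auto simp: P_def R_def g_def o_def intro: LIMSEQ_subseq_LIMSEQ[unfolded o_def]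
        filterlim_compose[OF _ filterlim_subseq])
qed

end
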